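(* Let $(Q,\Omega)$ be a quiver with relations such that $\Omega$ is locally finite, let $R$ be a minimal set of relations of $(Q,\Omega)$, and let $C=C(Q,\Omega)$. Let $n\in Q_0$ be a vertex, let $S_n$ be the simple left $C$-comodule corresponding to $n$, and let $R_n=\{r\in R\mid t(r)=n\}$. Consider the sequence $$0\longrightarrow S_n\longrightarrow e_nC\overset{f}{\longrightarrow}\bigoplus_{a\in Q_1,\,t(a)=n}e_{s(a)}C\overset{g}{\longrightarrow}\bigoplus_{r\in R_n}e_{s(r)}C,$$ where the first map is the embedding; $f(x)=\sum_{a\in Q_1,\,t(a)=n}\iota(a)x$ for $x\in e_nC$, with $\iota(a)x$ regarded as an element of the summand $e_{s(a)}C$ indexed by $a$; and, for $x$ in the summand $e_{s(a)}C$ indexed by $a$, $g(x)=0$ if $a\notin \mathrm{lead}(R_n)$, while $g(x)=\sum_{r\in R_n}\iota(ra^{-1})x$ if $a\in\mathrm{lead}(R_n)$, with $\iota(ra^{-1})x$ regarded as an element of the summand $e_{s(r)}C$ indexed by $r$. (Summands indexed by different arrows, respectively different relations, are distinguished even if these have the same source and target.) Then this sequence is exact.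
   Context: $\mathbf k$ is an algebraically closed field of characteristic zero. For a quiver $Q$ (possibly infinite) with vertex set $Q_0$ and arrow set $Q_1$, $s(a)$ and $t(a)$ are the source and target of an arrow $a$; a nontrivial path is $p=a_1a_2\cdots a_n$ with $s(a_{i+1})=t(a_i)$, and $s(p)=s(a_1)$, $t(p)=t(a_n)$; vertices are the paths of length $0$. The path algebra $\mathbf kQ$ has the paths as basis, with product of $p$ and $q$ equal to $pq$ if $s(q)=t(p)$ and $0$ otherwise; $\mathbf kQ_{\ge m}$ is the span of the paths of length at least $m$. The path coalgebra $CQ$ has the paths as basis, with $\Delta(p)=\sum_{p=p'p''}p'\otimes p''$ and counit $1$ on vertices, $0$ on nontrivial paths. The bilinear form $\langle\ ,\ \rangle:CQ\times\mathbf kQ\to\mathbf k$, $\langle p,q\rangle=\delta_{p,q}$ for paths $p,q$, induces the injective multiplicative map $\iota:\mathbf kQ\to(CQ)^*$, $\iota(y)=\langle-,y\rangle$. For an arrow $a$ and a path $p=a_1\cdots a_n$, $pa^{-1}=a_1\cdots a_{n-1}$ if $a=a_n$ and $0$ otherwise, extended linearly. A quiver with relations is a pair $(Q,\Omega)$ with $\Omega$ a two-sided ideal of $\mathbf kQ$ contained in $\mathbf kQ_{\ge2}$; its path coalgebra is the subcoalgebra $C(Q,\Omega)=\{x\in CQ\mid\langle x,\Omega\rangle=0\}$ of $CQ$. A minimal set of relations of $(Q,\Omega)$ is a subset $R\subseteq\Omega$ such that (1) $R$ generates the ideal $\Omega$ and no proper subset of $R$ generates $\Omega$; (2) each $r\in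 R$ is a linear combination of paths with a common source, denoted $s(r)$, and a common target, denoted $t(r)$. The ideal $\Omega$ is locally finite if there is a minimal set of relations $R$ such that for all vertices $i,j$ the set $\{r\in R\mid s(r)=i,t(r)=j\}$ is finite (possibly empty); this property is regarded as independent of the choice of $R$, so it is understood to hold for the chosen $R$. For a nontrivial path $p=a_1\cdots a_n$, $\mathrm{lead}(p)=\{a_n\}$; $\mathrm{lead}(p)=\emptyset$ for a trivial path; for $x=k_1p_1+\cdots+k_mp_m$ (distinct paths, nonzero coefficients), $\mathrm{lead}(x)=\bigcup_i\mathrm{lead}(p_i)$; for a subset $S\subseteq\mathbf kQ$, $\mathrm{lead}(S)=\bigcup_{x\in S}\mathrm{lead}(x)$. For a vertex $i$, $e_i\in(CQ)^*$ is the corresponding idempotent ($e_i=\iota(i)$). $(CQ)^*$ acts on $C\subseteq CQ$ on the left by $\varphi x=\sum_{(x)}x_{(1)}\varphi(x_{(2)})$; thus $e_iC$ consists of the elements of $C$ that are linear combinations of paths with target $i$, a left $C$-comodule via $\Delta$, and $S_i=\mathbf k\,i\subseteq e_iC$. *)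

theory Defs
  imports
    "Graph_Theory.Arc_Walk"
    "HOL-Computational_Algebra.Polynomial"
    "HOL-Library.Poly_Mapping"
    "HOL-Library.Function_Algebras"
begin

text \<open>
  A quiver is a \<^locale>\<open>wf_digraph\<close> (loops, parallel arrows and infinite vertex and arrow sets are
  allowed) with source \<^const>\<open>tail\<close> and target \<^const>\<open>head\<close>. A path is its source vertex together
  with its list of arrows, in the order in which they are traversed; \<open>(i, [])\<close> is the trivial path
  at \<open>i\<close>.
\<close>

type_synonym ('v, 'a) qpath = "'v \<times> 'a list"

definition psource :: "('v, 'a) qpath \<Rightarrow> 'v" where
  "psource p = fst p"

definition ptarget :: "('v, 'a) pre_digraph \<Rightarrow> ('v, 'a) qpath \<Rightarrow> 'v" where
  "ptarget Q p = pre_digraph.awlast Q (fst p) (snd p)"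

definition paths :: "('v, 'a) pre_digraph \<Rightarrow> ('v, 'a) qpath set" where
  "paths Q = {p. pre_digraph.awalk Q (psource p) (snd p) (ptarget Q p)}"

definition pconcat :: "('v, 'a) qpath \<Rightarrow> ('v, 'a) qpath \<Rightarrow> ('v, 'a) qpath" where
  "pconcat p q = (fst p, snd p @ snd q)"

definition arrow_path :: "('v, 'a) pre_digraph \<Rightarrow> 'a \<Rightarrow> ('v, 'a) qpath" where
  "arrow_path Q a = (tail Q a, [a])"

text \<open>
  A vector space with basis \<open>B\<close> consists of the finitely supported functions \<open>B \<Rightarrow>\<^sub>0 'k\<close>. In
  particular \<open>kQ\<close> and \<open>CQ\<close> have the same underlying space.
\<close>

definition fscale :: "'k::field \<Rightarrow> ('b \<Rightarrow>\<^sub>0 'k) \<Rightarrow> ('b \<Rightarrow>\<^sub>0 'k)" where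
  "fscale c = Poly_Mapping.map ((*) c)"

definition path_space :: "('v, 'a) pre_digraph \<Rightarrow> (('v, 'a) qpath \<Rightarrow>\<^sub>0 'k::field) set" where
  "path_space Q = {x. Poly_Mapping.keys x \<subseteq> paths Q}"

definition path_space_ge ::
    "('v, 'a) pre_digraph \<Rightarrow> nat \<Rightarrow> (('v, 'a) qpath \<Rightarrow>\<^sub>0 'k::field) set" where
  "path_space_ge Q m =
     module.span fscale {Poly_Mapping.single p 1 | p. p \<in> paths Q \<and> m \<le> length (snd p)}"

definition path_mult ::
    "('v, 'a) pre_digraph \<Rightarrow> (('v, 'a) qpath \<Rightarrow>\<^sub>0 'k::field) \<Rightarrow> (('v, 'a) qpath \<Rightarrow>\<^sub>0 'k)
      \<Rightarrow> (('v, 'a) qpath \<Rightarrow>\<^sub>0 'k)" where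
  "path_mult Q x y =
     (\<Sum>p\<in>Poly_Mapping.keys x. \<Sum>q\<in>Poly_Mapping.keys y.
        if psource q = ptarget Q p
        then Poly_Mapping.single (pconcat p q) (Poly_Mapping.lookup x p * Poly_Mapping.lookup y q)
        else 0)"

text \<open>
  For a vector space \<open>V\<close>, the tensor product \<open>CQ \<otimes> V\<close> is the space of finitely supported functions
  from paths to \<open>V\<close>: \<open>z\<close> stands for the sum of the tensors \<open>p \<otimes> z p\<close>. Hence \<open>id \<otimes> h\<close> is
  \<open>Poly_Mapping.map h\<close> for linear \<open>h\<close>, and \<open>CQ \<otimes> CQ\<close> is the type of the values of \<open>comult\<close> below.
  The argument \<open>s\<close> is the scalar multiplication of \<open>V\<close>.
\<close>

definition tensor_elt :: "('k::zero \<Rightarrow> 'w \<Rightarrow> 'w::zero) \<Rightarrow> ('p \<Rightarrow>\<^sub>0 'k) \<Rightarrow> 'w \<Rightarrow> ('p \<Rightarrow>\<^sub>0 'w)" where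
  "tensor_elt s x v = Poly_Mapping.map (\<lambda>c. s c v) x"

definition tensor ::
    "('k::field \<Rightarrow> 'w \<Rightarrow> 'w::ab_group_add) \<Rightarrow> ('p \<Rightarrow>\<^sub>0 'k) set \<Rightarrow> 'w set \<Rightarrow> ('p \<Rightarrow>\<^sub>0 'w) set" where
  "tensor s C M =
     module.span (\<lambda>c. Poly_Mapping.map (s c)) {tensor_elt s x v | x v. x \<in> C \<and> v \<in> M}"

definition splittings ::
    "('v, 'a) pre_digraph \<Rightarrow> ('v, 'a) qpath \<Rightarrow> (('v, 'a) qpath \<times> ('v, 'a) qpath) set" where
  "splittings Q p =
     {(p', p''). p' \<in> paths Q \<and> p'' \<in> paths Q \<and> psource p'' = ptarget Q p' \<and> pconcat p' p'' = p}"

definition comult ::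
    "('v, 'a) pre_digraph \<Rightarrow> (('v, 'a) qpath \<Rightarrow>\<^sub>0 'k::field)
      \<Rightarrow> (('v, 'a) qpath \<Rightarrow>\<^sub>0 (('v, 'a) qpath \<Rightarrow>\<^sub>0 'k))" where
  "comult Q x =
     (\<Sum>p\<in>Poly_Mapping.keys x. \<Sum>(p', p'')\<in>splittings Q p.
        Poly_Mapping.single p' (Poly_Mapping.single p'' (Poly_Mapping.lookup x p)))"

definition path_counit :: "('v, 'a) qpath \<Rightarrow> 'k::field" where
  "path_counit p = (if snd p = [] then 1 else 0)"

definition pairing :: "('p \<Rightarrow>\<^sub>0 'k::field) \<Rightarrow> ('p \<Rightarrow>\<^sub>0 'k) \<Rightarrow> 'k" where
  "pairing x y = (\<Sum>p\<in>Poly_Mapping.keys x. Poly_Mapping.lookup x p * Poly_Mapping.lookup y p)"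

definition iota :: "('p \<Rightarrow>\<^sub>0 'k::field) \<Rightarrow> ('p \<Rightarrow>\<^sub>0 'k) \<Rightarrow> 'k" where
  "iota y = (\<lambda>x. pairing x y)"

definition dual_act ::
    "('v, 'a) pre_digraph \<Rightarrow> ((('v, 'a) qpath \<Rightarrow>\<^sub>0 'k::field) \<Rightarrow> 'k)
      \<Rightarrow> (('v, 'a) qpath \<Rightarrow>\<^sub>0 'k) \<Rightarrow> (('v, 'a) qpath \<Rightarrow>\<^sub>0 'k)" where
  "dual_act Q \<phi> x =
     (\<Sum>p\<in>Poly_Mapping.keys (comult Q x).
        Poly_Mapping.single p (\<phi> (Poly_Mapping.lookup (comult Q x) p)))"

definition two_sided_ideal ::
    "('v, 'a) pre_digraph \<Rightarrow> (('v, 'a) qpath \<Rightarrow>\<^sub>0 'k::field) set \<Rightarrow> bool" where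
  "two_sided_ideal Q I \<longleftrightarrow>
     I \<subseteq> path_space Q \<and> module.subspace fscale I \<and>
     (\<forall>x\<in>I. \<forall>y\<in>path_space Q. path_mult Q x y \<in> I \<and> path_mult Q y x \<in> I)"

definition generated_ideal ::
    "('v, 'a) pre_digraph \<Rightarrow> (('v, 'a) qpath \<Rightarrow>\<^sub>0 'k::field) set \<Rightarrow> (('v, 'a) qpath \<Rightarrow>\<^sub>0 'k) set" where
  "generated_ideal Q S = \<Inter>{I. two_sided_ideal Q I \<and> S \<subseteq> I}"

definition quiver_with_relations ::
    "('v, 'a) pre_digraph \<Rightarrow> (('v, 'a) qpath \<Rightarrow>\<^sub>0 'k::field) set \<Rightarrow> bool" where
  "quiver_with_relations Q \<Omega> \<longleftrightarrow>
     wf_digraph Q \<and> two_sided_ideal Q \<Omega> \<and> \<Omega> \<subseteq> path_space_ge Q 2"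

definition path_coalgebra ::
    "('v, 'a) pre_digraph \<Rightarrow> (('v, 'a) qpath \<Rightarrow>\<^sub>0 'k::field) set \<Rightarrow> (('v, 'a) qpath \<Rightarrow>\<^sub>0 'k) set" where
  "path_coalgebra Q \<Omega> = {x \<in> path_space Q. \<forall>y\<in>\<Omega>. pairing x y = 0}"

definition minimal_relations ::
    "('v, 'a) pre_digraph \<Rightarrow> (('v, 'a) qpath \<Rightarrow>\<^sub>0 'k::field) set \<Rightarrow> (('v, 'a) qpath \<Rightarrow>\<^sub>0 'k) set
      \<Rightarrow> bool" where
  "minimal_relations Q \<Omega> R \<longleftrightarrow>
     R \<subseteq> \<Omega> \<and> generated_ideal Q R = \<Omega> \<and> (\<forall>R'. R' \<subset> R \<longrightarrow> generated_ideal Q R' \<noteq> \<Omega>) \<and>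
     (\<forall>r\<in>R. \<exists>i\<in>verts Q. \<exists>j\<in>verts Q. \<forall>p\<in>Poly_Mapping.keys r. psource p = i \<and> ptarget Q p = j)"

text \<open>
  The members of a minimal set of relations are nonzero (0 could be dropped), so for them the
  common source and the common target are unique.
\<close>

definition rsource :: "(('v, 'a) qpath \<Rightarrow>\<^sub>0 'k::field) \<Rightarrow> 'v" where
  "rsource r = (THE i. \<forall>p\<in>Poly_Mapping.keys r. psource p = i)"

definition rtarget :: "('v, 'a) pre_digraph \<Rightarrow> (('v, 'a) qpath \<Rightarrow>\<^sub>0 'k::field) \<Rightarrow> 'v" where
  "rtarget Q r = (THE j. \<forall>p\<in>Poly_Mapping.keys r. ptarget Q p = j)"

definition locally_finite_relations ::
    "('v, 'a) pre_digraph \<Rightarrow> (('v, 'a) qpath \<Rightarrow>\<^sub>0 'k::field) set \<Rightarrow> bool" where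
  "locally_finite_relations Q R \<longleftrightarrow>
     (\<forall>i\<in>verts Q. \<forall>j\<in>verts Q. finite {r \<in> R. rsource r = i \<and> rtarget Q r = j})"

definition path_lead :: "('v, 'a) qpath \<Rightarrow> 'a set" where
  "path_lead p = (if snd p = [] then {} else {last (snd p)})"

definition lead :: "(('v, 'a) qpath \<Rightarrow>\<^sub>0 'k::field) set \<Rightarrow> 'a set" where
  "lead S = (\<Union>x\<in>S. \<Union>p\<in>Poly_Mapping.keys x. path_lead p)"

text \<open>The element \<open>x a\<^sup>-\<^sup>1\<close>.\<close>

definition strip_arrow ::
    "(('v, 'a) qpath \<Rightarrow>\<^sub>0 'k::field) \<Rightarrow> 'a \<Rightarrow> (('v, 'a) qpath \<Rightarrow>\<^sub>0 'k)" where
  "strip_arrow x a =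
     (\<Sum>p\<in>Poly_Mapping.keys x.
        if snd p \<noteq> [] \<and> last (snd p) = a
        then Poly_Mapping.single (fst p, butlast (snd p)) (Poly_Mapping.lookup x p) else 0)"

text \<open>
  The space of a comodule is a subspace of the ambient vector space \<open>'w\<close> with scalar
  multiplication \<open>cscale\<close>; its coaction takes values in \<open>CQ \<otimes> 'w\<close>.
\<close>

record (overloaded) ('p, 'k, 'w) comodule =
  cspace :: "'w set"
  cscale :: "'k \<Rightarrow> 'w \<Rightarrow> 'w"
  coact :: "'w \<Rightarrow> ('p \<Rightarrow>\<^sub>0 'w::zero)"

definition subcoalgebra ::
    "('v, 'a) pre_digraph \<Rightarrow> (('v, 'a) qpath \<Rightarrow>\<^sub>0 'k::field) set \<Rightarrow> bool" where
  "subcoalgebra Q C \<longleftrightarrow>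
     C \<subseteq> path_space Q \<and> module.subspace fscale C \<and> comult Q ` C \<subseteq> tensor fscale C C"

definition linear_map_on ::
    "'w set \<Rightarrow> ('k \<Rightarrow> 'w \<Rightarrow> 'w::plus) \<Rightarrow> ('k \<Rightarrow> 'u \<Rightarrow> 'u::plus) \<Rightarrow> ('w \<Rightarrow> 'u) \<Rightarrow> bool" where
  "linear_map_on M s t h \<longleftrightarrow>
     (\<forall>x\<in>M. \<forall>y\<in>M. h (x + y) = h x + h y) \<and> (\<forall>c. \<forall>x\<in>M. h (s c x) = t c (h x))"

text \<open>
  The last two conjuncts are coassociativity, \<open>(\<Delta> \<otimes> id) \<circ> \<rho> = (id \<otimes> \<rho>) \<circ> \<rho>\<close>, and the counit law,
  \<open>(\<epsilon> \<otimes> id) \<circ> \<rho> = id\<close>.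
\<close>

definition left_comodule ::
    "('v, 'a) pre_digraph \<Rightarrow> (('v, 'a) qpath \<Rightarrow>\<^sub>0 'k::field) set
      \<Rightarrow> (('v, 'a) qpath, 'k, 'w::ab_group_add) comodule \<Rightarrow> bool" where
  "left_comodule Q C M \<longleftrightarrow>
     subcoalgebra Q C \<and>
     vector_space (cscale M) \<and> module.subspace (cscale M) (cspace M) \<and>
     linear_map_on (cspace M) (cscale M) (\<lambda>c. Poly_Mapping.map (cscale M c)) (coact M) \<and>
     coact M ` cspace M \<subseteq> tensor (cscale M) C (cspace M) \<and>
     (\<forall>x\<in>cspace M.
        (\<Sum>p\<in>Poly_Mapping.keys (coact M x).
           Poly_Mapping.map (\<lambda>y. tensor_elt (cscale M) y (Poly_Mapping.lookup (coact M x) p))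
             (comult Q (Poly_Mapping.single p 1)))
        = Poly_Mapping.map (coact M) (coact M x)) \<and>
     (\<forall>x\<in>cspace M.
        (\<Sum>p\<in>Poly_Mapping.keys (coact M x).
           cscale M (path_counit p) (Poly_Mapping.lookup (coact M x) p)) = x)"

definition comodule_hom ::
    "('p, 'k::field, 'w::ab_group_add) comodule \<Rightarrow> ('p, 'k, 'u::ab_group_add) comodule
      \<Rightarrow> ('w \<Rightarrow> 'u) \<Rightarrow> bool" where
  "comodule_hom M N h \<longleftrightarrow>
     h ` cspace M \<subseteq> cspace N \<and> linear_map_on (cspace M) (cscale M) (cscale N) h \<and>
     (\<forall>x\<in>cspace M. coact N (h x) = Poly_Mapping.map h (coact M x))"

definition exact_at :: "'w set \<Rightarrow> ('w \<Rightarrow> 'u) \<Rightarrow> 'u set \<Rightarrow> ('u \<Rightarrow> 'z::zero) \<Rightarrow> bool" where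
  "exact_at M g N h \<longleftrightarrow> g ` M = {y \<in> N. h y = 0}"

text \<open>
  Elements of a direct sum are families indexed by \<open>I\<close>, extended by zero outside \<open>I\<close>, with finitely
  many nonzero components.
\<close>

definition direct_sum ::
    "'i set \<Rightarrow> ('i \<Rightarrow> ('p, 'k, 'w::ab_group_add) comodule) \<Rightarrow> ('p, 'k, 'i \<Rightarrow> 'w) comodule" where
  "direct_sum I M =
     \<lparr> cspace = {m. finite {i. m i \<noteq> 0} \<and> {i. m i \<noteq> 0} \<subseteq> I \<and> (\<forall>i\<in>I. m i \<in> cspace (M i))},
       cscale = (\<lambda>c m i. cscale (M i) c (m i)),
       coact = (\<lambda>m. \<Sum>i\<in>{i. m i \<noteq> 0}.
                  Poly_Mapping.map (\<lambda>v j. if j = i then v else 0) (coact (M i) (m i))) \<rparr>"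

definition simple_comodule ::
    "('v, 'a) pre_digraph \<Rightarrow> 'v \<Rightarrow> (('v, 'a) qpath, 'k::field, ('v, 'a) qpath \<Rightarrow>\<^sub>0 'k) comodule" where
  "simple_comodule Q i =
     \<lparr> cspace = module.span fscale {Poly_Mapping.single (i, []) 1},
       cscale = fscale, coact = comult Q \<rparr>"

text \<open>The comodule \<open>e\<^sub>i C\<close>.\<close>

definition vertex_comodule ::
    "('v, 'a) pre_digraph \<Rightarrow> (('v, 'a) qpath \<Rightarrow>\<^sub>0 'k::field) set \<Rightarrow> 'v
      \<Rightarrow> (('v, 'a) qpath, 'k, ('v, 'a) qpath \<Rightarrow>\<^sub>0 'k) comodule" where
  "vertex_comodule Q C i =
     \<lparr> cspace = dual_act Q (iota (Poly_Mapping.single (i, []) 1)) ` C,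
       cscale = fscale, coact = comult Q \<rparr>"

definition arrows_into :: "('v, 'a) pre_digraph \<Rightarrow> 'v \<Rightarrow> 'a set" where
  "arrows_into Q n = {a \<in> arcs Q. head Q a = n}"

definition relations_into ::
    "('v, 'a) pre_digraph \<Rightarrow> (('v, 'a) qpath \<Rightarrow>\<^sub>0 'k::field) set \<Rightarrow> 'v
      \<Rightarrow> (('v, 'a) qpath \<Rightarrow>\<^sub>0 'k) set" where
  "relations_into Q R n = {r \<in> R. rtarget Q r = n}"

definition map_f ::
    "('v, 'a) pre_digraph \<Rightarrow> 'v \<Rightarrow> (('v, 'a) qpath \<Rightarrow>\<^sub>0 'k::field) \<Rightarrow> 'a \<Rightarrow> (('v, 'a) qpath \<Rightarrow>\<^sub>0 'k)" where
  "map_f Q n x =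
     (\<lambda>a. if a \<in> arrows_into Q n
          then dual_act Q (iota (Poly_Mapping.single (arrow_path Q a) 1)) x else 0)"

text \<open>The restriction of \<open>g\<close> to the summand indexed by the arrow \<open>a\<close>, and its linear extension.\<close>

definition map_g_summand ::
    "('v, 'a) pre_digraph \<Rightarrow> (('v, 'a) qpath \<Rightarrow>\<^sub>0 'k::field) set \<Rightarrow> 'v \<Rightarrow> 'a
      \<Rightarrow> (('v, 'a) qpath \<Rightarrow>\<^sub>0 'k) \<Rightarrow> (('v, 'a) qpath \<Rightarrow>\<^sub>0 'k) \<Rightarrow> (('v, 'a) qpath \<Rightarrow>\<^sub>0 'k)" where
  "map_g_summand Q R n a x =
     (if a \<in> lead (relations_into Q R n)
      then (\<lambda>r. if r \<in> relations_into Q R n then dual_act Q (iota (strip_arrow r a)) x else 0)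
      else 0)"

definition map_g ::
    "('v, 'a) pre_digraph \<Rightarrow> (('v, 'a) qpath \<Rightarrow>\<^sub>0 'k::field) set \<Rightarrow> 'v
      \<Rightarrow> ('a \<Rightarrow> (('v, 'a) qpath \<Rightarrow>\<^sub>0 'k)) \<Rightarrow> (('v, 'a) qpath \<Rightarrow>\<^sub>0 'k) \<Rightarrow> (('v, 'a) qpath \<Rightarrow>\<^sub>0 'k)" where
  "map_g Q R n m = (\<Sum>a\<in>{a. m a \<noteq> 0}. map_g_summand Q R n a (m a))"

end

theory Submission
  imports Defs
begin

text \<open>
  Everything is expressed through the action of the path algebra on \<open>CQ\<close>, \<open>y x = \<iota>(y) x\<close>. It is
  the transpose of right multiplication: \<open>\<langle>x, w y\<rangle> = \<langle>y x, w\<rangle>\<close> (\<open>pairing_path_mult\<close>). Hence it is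
  a left module structure that commutes with \<open>\<Delta>\<close>, the coalgebra \<open>C\<close> is a submodule because \<open>\<Omega>\<close> is
  an ideal, and an element \<open>x\<close> of \<open>CQ\<close> lies in \<open>C\<close> exactly when \<open>y x = 0\<close> for all \<open>y\<close> in \<open>\<Omega>\<close>
  (\<open>act_ideal_eq_0\<close>, \<open>path_coalgebraI_act\<close>).

  An arrow \<open>a\<close> acts by deleting a final \<open>a\<close> from each path. So \<open>f(x) = 0\<close> only if \<open>x\<close> is a multiple
  of the trivial path \<open>n\<close>, which is exactness at \<open>e\<^sub>n C\<close>. A relation \<open>r\<close> is the sum of the products
  \<open>(r a\<^sup>-\<^sup>1) a\<close>, so the component of \<open>g(f(x))\<close> at \<open>r\<close> is \<open>r x\<close> (\<open>map_g_map_f\<close>), and this is 0 for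
  \<open>x\<close> in \<open>C\<close>. Conversely, let \<open>g(m) = 0\<close>. Appending the arrow \<open>a\<close> to the component of \<open>m\<close> at \<open>a\<close>
  and adding up gives an \<open>x\<close> in \<open>CQ\<close> with \<open>f(x) = m\<close> (\<open>map_f_preimage\<close>), and then \<open>r x = 0\<close> for
  every relation \<open>r\<close>. Moreover every arrow maps \<open>x\<close> into \<open>C\<close>, as the components of \<open>m\<close> lie in \<open>C\<close>.
  Under these two conditions the elements of \<open>\<Omega>\<close> that annihilate \<open>x\<close> form an ideal that contains
  all relations; so all of \<open>\<Omega>\<close> annihilates \<open>x\<close>, and \<open>x\<close> lies in \<open>C\<close>
  (\<open>path_coalgebraI_relations\<close>).

  The comodule structures need two more facts: \<open>\<Delta>(C)\<close> is contained in \<open>C \<otimes> C\<close>, which is linear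
  algebra over a field (\<open>tensor_path_coalgebraI\<close>), and the values of \<open>g\<close> have finite support, which
  is where local finiteness enters (\<open>finite_support_map_g\<close>).
\<close>

section \<open>Finitely supported functions and the pairing\<close>

abbreviation lookup :: "('p \<Rightarrow>\<^sub>0 'b::zero) \<Rightarrow> 'p \<Rightarrow> 'b" where
  "lookup \<equiv> Poly_Mapping.lookup"

abbreviation keys :: "('p \<Rightarrow>\<^sub>0 'b::zero) \<Rightarrow> 'p set" where
  "keys \<equiv> Poly_Mapping.keys"

abbreviation single :: "'p \<Rightarrow> 'b \<Rightarrow> ('p \<Rightarrow>\<^sub>0 'b::zero)" where
  "single \<equiv> Poly_Mapping.single"

lemma lookup_map: "f 0 = 0 \<Longrightarrow> lookup (Poly_Mapping.map f x) p = f (lookup x p)"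
  by transfer (simp add: when_def)

lemma lookup_fscale [simp]: "lookup (fscale c x) p = c * lookup x p"
  by (simp add: fscale_def lookup_map)

lemma sum_fun_apply: "sum f A x = (\<Sum>a\<in>A. f a x)"
  for f :: "'a \<Rightarrow> 'b \<Rightarrow> 'c::comm_monoid_add"
  by (induction A rule: infinite_finite_induct) auto

lemma vector_space_map:
  fixes s :: "'k::field \<Rightarrow> 'w \<Rightarrow> 'w::ab_group_add"
  assumes "vector_space s"
  shows "vector_space (\<lambda>c. Poly_Mapping.map (s c) :: ('p \<Rightarrow>\<^sub>0 'w) \<Rightarrow> _)"
proof -
  interpret vector_space s by fact
  show ?thesis
    by unfold_locales
      (auto intro!: poly_mapping_eqI simp: lookup_map lookup_add scale_right_distrib
        scale_left_distrib)
qed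

interpretation fs: vector_space "fscale :: 'k::field \<Rightarrow> ('p \<Rightarrow>\<^sub>0 'k) \<Rightarrow> _"
  by unfold_locales (auto intro!: poly_mapping_eqI simp: lookup_add algebra_simps)

lemma subspace_support: "fs.subspace {x :: 'p \<Rightarrow>\<^sub>0 'k::field. keys x \<subseteq> S}"
proof -
  have "keys x \<subseteq> S \<longleftrightarrow> (\<forall>p. p \<notin> S \<longrightarrow> lookup x p = 0)" for x :: "'p \<Rightarrow>\<^sub>0 'k"
    by (auto simp: in_keys_iff)
  then show ?thesis by (simp add: fs.subspace_def lookup_add)
qed

lemma sum_single_keys: "(\<Sum>p\<in>keys x. single p (lookup x p)) = x"
  by (rule poly_mapping_eqI) (auto simp: lookup_sum lookup_single when_def in_keys_iff)

lemma pairing_superset: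
  assumes "finite A" "keys x \<subseteq> A"
  shows "pairing x y = (\<Sum>p\<in>A. lookup x p * lookup y p)"
  unfolding pairing_def using assms
  by (intro sum.mono_neutral_left) (auto simp: in_keys_iff)

lemma pairing_commute: "pairing x y = pairing y x"
  using pairing_superset[of "keys x \<union> keys y" x y] pairing_superset[of "keys x \<union> keys y" y x]
  by (simp add: mult.commute)

lemma pairing_add_left: "pairing (x + x') y = pairing x y + pairing x' y"
proof -
  let ?A = "keys x \<union> keys x'"
  have "keys (x + x') \<subseteq> ?A" by (rule keys_add)
  then show ?thesis
    by (simp add: pairing_superset[of ?A] lookup_add distrib_right sum.distrib)
qed

lemma pairing_fscale_left: "pairing (fscale c x) y = c * pairing x y"
proof -
  have "keys (fscale c x) \<subseteq> keys x" by (auto simp: in_keys_iff)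
  then show ?thesis
    by (simp add: pairing_superset[of "keys x"] sum_distrib_left mult.assoc)
qed

lemma pairing_zero_left [simp]: "pairing 0 y = 0"
  by (simp add: pairing_def)

lemma pairing_sum_left: "pairing (sum f A) y = (\<Sum>a\<in>A. pairing (f a) y)"
  by (induction A rule: infinite_finite_induct) (auto simp: pairing_add_left)

lemma pairing_add_right: "pairing x (y + y') = pairing x y + pairing x y'"
  by (metis pairing_add_left pairing_commute)

lemma pairing_fscale_right: "pairing x (fscale c y) = c * pairing x y"
  by (metis pairing_fscale_left pairing_commute)

lemma pairing_zero_right [simp]: "pairing x 0 = 0"
  by (metis pairing_zero_left pairing_commute)

lemma pairing_sum_right: "pairing x (sum f A) = (\<Sum>a\<in>A. pairing x (f a))"
  by (induction A rule: infinite_finite_induct) (auto simp: pairing_add_right)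

lemma pairing_single_right [simp]: "pairing x (single p c) = lookup x p * c"
  by (subst pairing_commute) (auto simp: pairing_def)

lemma pairing_nonzeroE:
  assumes "pairing x y \<noteq> 0"
  obtains p where "p \<in> keys x" "p \<in> keys y"
proof -
  obtain p where "p \<in> keys x" "lookup x p * lookup y p \<noteq> 0"
    using assms unfolding pairing_def by (metis (no_types, lifting) sum.neutral)
  then show ?thesis using that[of p] by (auto simp: in_keys_iff)
qed

section \<open>Paths and their composition\<close>

definition composable ::
    "('v, 'a) pre_digraph \<Rightarrow> ('v, 'a) qpath \<Rightarrow> ('v, 'a) qpath \<Rightarrow> bool" where
  "composable Q p q \<longleftrightarrow> p \<in> paths Q \<and> q \<in> paths Q \<and> psource q = ptarget Q p"

lemma ptarget_conv: "ptarget Q p = (if snd p = [] then fst p else head Q (last (snd p)))"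
  by (simp add: ptarget_def pre_digraph.awalk_verts_conv)

lemma in_paths_iff:
  "p \<in> paths Q \<longleftrightarrow> fst p \<in> verts Q \<and> set (snd p) \<subseteq> arcs Q
     \<and> pre_digraph.cas Q (fst p) (snd p) (ptarget Q p)"
  by (simp add: paths_def pre_digraph.awalk_def psource_def)

lemma psource_pconcat [simp]: "psource (pconcat p q) = psource p"
  by (simp add: psource_def pconcat_def)

lemma pconcat_assoc: "pconcat (pconcat p q) r = pconcat p (pconcat q r)"
  by (simp add: pconcat_def)

lemma ptarget_pconcat: "psource q = ptarget Q p \<Longrightarrow> ptarget Q (pconcat p q) = ptarget Q q"
  by (auto simp: ptarget_conv pconcat_def psource_def)

lemma pconcat_in_paths:
  assumes "composable Q p q"
  shows "pconcat p q \<in> paths Q"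
proof -
  have "ptarget Q (pconcat p q) = ptarget Q q"
    using assms by (simp add: composable_def ptarget_pconcat)
  then show ?thesis
    using assms
    by (auto simp: composable_def in_paths_iff pre_digraph.cas_append_iff pconcat_def psource_def
        ptarget_def)
qed

text \<open>
  This carries the associativity of path composition: both sides say that the composite of the
  three paths exists.
\<close>

lemma composable_assoc:
  "composable Q p q \<and> composable Q (pconcat p q) r
     \<longleftrightarrow> composable Q q r \<and> composable Q p (pconcat q r)"
proof
  assume *: "composable Q p q \<and> composable Q (pconcat p q) r"
  then have qr: "composable Q q r"
    by (auto simp: composable_def ptarget_pconcat)
  with * pconcat_in_paths[OF qr] show "composable Q q r \<and> composable Q p (pconcat q r)"
    by (auto simp: composable_def)
next
  assume *: "composable Q q r \<and> composable Q p (pconcat q r)"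
  then have pq: "composable Q p q"
    by (auto simp: composable_def)
  with * pconcat_in_paths[OF pq] show "composable Q p q \<and> composable Q (pconcat p q) r"
    by (auto simp: composable_def ptarget_pconcat)
qed

lemma trivial_in_paths_iff: "(i, []) \<in> paths Q \<longleftrightarrow> i \<in> verts Q"
  by (auto simp: in_paths_iff pre_digraph.cas.simps ptarget_conv)

lemma ptarget_in_verts: "wf_digraph Q \<Longrightarrow> p \<in> paths Q \<Longrightarrow> ptarget Q p \<in> verts Q"
  unfolding paths_def by (auto dest: wf_digraph.awalk_last_in_verts)

lemma composable_trivial_left:
  "composable Q (i, []) q \<longleftrightarrow> q \<in> paths Q \<and> psource q = i"
  by (auto simp: composable_def ptarget_conv psource_def in_paths_iff pre_digraph.cas.simps)

lemma composable_trivial_right: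
  assumes "wf_digraph Q"
  shows "composable Q p (i, []) \<longleftrightarrow> p \<in> paths Q \<and> ptarget Q p = i"
  using ptarget_in_verts[OF assms, of p]
  by (auto simp: composable_def trivial_in_paths_iff psource_def)

lemma pconcat_trivial [simp]: "pconcat p (i, []) = p" "pconcat (psource q, []) q = q"
  by (auto simp: pconcat_def psource_def)

lemma arrow_in_paths: "wf_digraph Q \<Longrightarrow> a \<in> arcs Q \<Longrightarrow> arrow_path Q a \<in> paths Q"
  by (auto simp: in_paths_iff arrow_path_def pre_digraph.cas.simps ptarget_conv
      wf_digraph.wellformed)

lemma arrow_path_simps [simp]:
  "psource (arrow_path Q a) = tail Q a" "ptarget Q (arrow_path Q a) = head Q a"
  by (auto simp: arrow_path_def psource_def ptarget_conv)

lemma composable_arrow: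
  "wf_digraph Q \<Longrightarrow> a \<in> arcs Q \<Longrightarrow> composable Q p (arrow_path Q a)
     \<longleftrightarrow> p \<in> paths Q \<and> ptarget Q p = tail Q a"
  by (auto simp: composable_def arrow_in_paths)

lemma pconcat_arrow: "pconcat p (arrow_path Q a) = (fst p, snd p @ [a])"
  by (simp add: pconcat_def arrow_path_def)

lemma butlast_in_paths: "(i, as @ [a]) \<in> paths Q \<Longrightarrow> (i, as) \<in> paths Q"
  by (simp add: in_paths_iff pre_digraph.cas_append_iff ptarget_def)

lemma snoc_path:
  assumes "wf_digraph Q" "(i, as @ [a]) \<in> paths Q"
  shows "composable Q (i, as) (arrow_path Q a)" "a \<in> arcs Q"
proof -
  show "a \<in> arcs Q"
    using assms(2) by (simp add: in_paths_iff)
  with assms show "composable Q (i, as) (arrow_path Q a)"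
    by (simp add: composable_arrow)
      (simp add: in_paths_iff pre_digraph.cas_append_iff ptarget_def pre_digraph.cas.simps)
qed

section \<open>The comultiplication\<close>

text \<open>The element \<open>\<Sum>x(pq) q\<close> of the second tensor factor that stands next to \<open>p\<close> in \<open>\<Delta>(x)\<close>.\<close>

abbreviation slice ::
    "('v, 'a) pre_digraph \<Rightarrow> (('v, 'a) qpath \<Rightarrow>\<^sub>0 'k::field) \<Rightarrow> ('v, 'a) qpath
      \<Rightarrow> (('v, 'a) qpath \<Rightarrow>\<^sub>0 'k)" where
  "slice Q x p \<equiv> lookup (comult Q x) p"

lemma finite_splittings: "finite (splittings Q p)"
proof (rule finite_subset)
  let ?f = "\<lambda>k. let p' = (fst p, take k (snd p)) in (p', (ptarget Q p', drop k (snd p)))"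
  show "splittings Q p \<subseteq> ?f ` {..length (snd p)}"
  proof
    fix pq assume "pq \<in> splittings Q p"
    then obtain i as bs where "pq = ((i, as), (ptarget Q (i, as), bs))" "p = (i, as @ bs)"
      by (auto simp: splittings_def pconcat_def psource_def)
    then have "pq = ?f (length as)" "length as \<le> length (snd p)"
      by (simp_all add: Let_def)
    then show "pq \<in> ?f ` {..length (snd p)}" by blast
  qed
qed simp

lemma lookup_slice:
  "lookup (slice Q x p) q = (if composable Q p q then lookup x (pconcat p q) else 0)"
proof -
  have "(\<Sum>(p', p'')\<in>splittings Q u. lookup (lookup (single p' (single p'' (lookup x u))) p) q)
     = (\<Sum>pq\<in>splittings Q u. if (p, q) = pq then lookup x u else 0)" for u
    by (rule sum.cong) (auto simp: lookup_single when_def split: if_splits)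
  also have "\<dots> u = (if composable Q p q \<and> pconcat p q = u then lookup x u else 0)" for u
    by (subst sum.delta'[OF finite_splittings]) (auto simp: splittings_def composable_def)
  finally have "lookup (slice Q x p) q
     = (\<Sum>u\<in>keys x. if composable Q p q \<and> pconcat p q = u then lookup x u else 0)"
    by (simp add: comult_def lookup_sum split_def)
  also have "\<dots> = (\<Sum>u\<in>keys x. if pconcat p q = u
      then if composable Q p q then lookup x u else 0 else 0)"
    by (rule sum.cong) auto
  also have "\<dots> = (if composable Q p q then lookup x (pconcat p q) else 0)"
    by (subst sum.delta') (auto simp: in_keys_iff)
  finally show ?thesis .
qed

text \<open>Coassociativity of the path coalgebra, in coordinates.\<close>

lemma slice_slice:
  "slice Q (slice Q x p) q = (if composable Q p q then slice Q x (pconcat p q) else 0)"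
  using composable_assoc[of Q p q]
  by (intro poly_mapping_eqI) (auto simp: lookup_slice pconcat_assoc)

lemma slice_eq_0_if_not_path: "p \<notin> paths Q \<Longrightarrow> slice Q x p = 0"
  by (rule poly_mapping_eqI) (auto simp: lookup_slice composable_def)

lemma keys_comult: "keys (comult Q x) \<subseteq> paths Q"
  by (metis in_keys_iff slice_eq_0_if_not_path subsetI)

lemma comult_add: "comult Q (x + y) = comult Q x + comult Q y"
  by (intro poly_mapping_eqI) (auto simp: lookup_slice lookup_add)

lemma comult_fscale: "comult Q (fscale c x) = Poly_Mapping.map (fscale c) (comult Q x)"
  by (intro poly_mapping_eqI) (auto simp: lookup_slice lookup_map)

lemma comult_zero [simp]: "comult Q 0 = 0"
  by (intro poly_mapping_eqI) (auto simp: lookup_slice)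

lemma comult_sum: "comult Q (sum f A) = (\<Sum>a\<in>A. comult Q (f a))"
  by (induction A rule: infinite_finite_induct) (auto simp: comult_add)

lemma slice_in_path_space: "slice Q x p \<in> path_space Q"
  by (auto simp: path_space_def in_keys_iff lookup_slice composable_def split: if_splits)

text \<open>The counit law of the path coalgebra: the trivial paths carry all of \<open>x\<close>.\<close>

lemma sum_slices_counit:
  assumes "finite A" "keys (comult Q x) \<subseteq> A" "x \<in> path_space Q"
  shows "(\<Sum>p\<in>A. fscale (path_counit p) (slice Q x p)) = x"
proof (rule poly_mapping_eqI)
  fix q
  have "lookup (\<Sum>p\<in>A. fscale (path_counit p) (slice Q x p)) q
     = (\<Sum>p\<in>A. if (psource q, []) = p then lookup (slice Q x p) q else 0)"
    unfolding lookup_sum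
  proof (rule sum.cong)
    fix p assume "p \<in> A"
    show "lookup (fscale (path_counit p) (slice Q x p)) q
      = (if (psource q, []) = p then lookup (slice Q x p) q else 0)"
      by (cases p) (auto simp: path_counit_def lookup_slice composable_trivial_left)
  qed simp
  also have "\<dots> = (if (psource q, []) \<in> A then lookup (slice Q x (psource q, [])) q else 0)"
    using assms(1) by (rule sum.delta')
  also have "\<dots> = lookup (slice Q x (psource q, [])) q"
  proof -
    have "slice Q x (psource q, []) = 0" if "(psource q, []) \<notin> A"
      using that assms(2) by (meson in_keys_iff subsetD)
    then show ?thesis by simp
  qed
  also have "\<dots> = lookup x q"
    using assms(3)
    by (auto simp: lookup_slice composable_trivial_left path_space_def in_keys_iff)
  finally show "lookup (\<Sum>p\<in>A. fscale (path_counit p) (slice Q x p)) q = lookup x q" .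
qed

section \<open>The action of the path algebra\<close>

abbreviation act ::
    "('v, 'a) pre_digraph \<Rightarrow> (('v, 'a) qpath \<Rightarrow>\<^sub>0 'k::field) \<Rightarrow> (('v, 'a) qpath \<Rightarrow>\<^sub>0 'k)
      \<Rightarrow> (('v, 'a) qpath \<Rightarrow>\<^sub>0 'k)" where
  "act Q y x \<equiv> dual_act Q (iota y) x"

lemma lookup_act: "lookup (act Q y x) p = pairing (slice Q x p) y"
proof -
  have "lookup (act Q y x) p
     = (\<Sum>u\<in>keys (comult Q x). if p = u then pairing (slice Q x u) y else 0)"
    unfolding dual_act_def lookup_sum iota_def
    by (rule sum.cong) (auto simp: lookup_single when_def)
  also have "\<dots> = pairing (slice Q x p) y"
    by (subst sum.delta') (auto simp: in_keys_iff)
  finally show ?thesis .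
qed

text \<open>
  The action of the path algebra is by comodule endomorphisms: \<open>\<Delta>\<close> splits off an initial part of a
  path, the action changes the end.
\<close>

lemma slice_act: "slice Q (act Q y x) p = act Q y (slice Q x p)"
  by (rule poly_mapping_eqI) (auto simp: lookup_act lookup_slice slice_slice)

lemma act_add_left: "act Q (y + y') x = act Q y x + act Q y' x"
  by (rule poly_mapping_eqI) (auto simp: lookup_act lookup_add pairing_add_right)

lemma act_zero_left [simp]: "act Q 0 x = 0"
  by (rule poly_mapping_eqI) (auto simp: lookup_act)

lemma act_fscale_left: "act Q (fscale c y) x = fscale c (act Q y x)"
  by (rule poly_mapping_eqI) (auto simp: lookup_act pairing_fscale_right)

lemma act_sum_left: "act Q (sum f A) x = (\<Sum>a\<in>A. act Q (f a) x)"
  by (induction A rule: infinite_finite_induct) (auto simp: act_add_left)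

lemma act_add_right: "act Q y (x + x') = act Q y x + act Q y x'"
  by (rule poly_mapping_eqI) (auto simp: lookup_act comult_add lookup_add pairing_add_left)

lemma act_zero_right [simp]: "act Q y 0 = 0"
  by (rule poly_mapping_eqI) (auto simp: lookup_act)

lemma act_fscale_right: "act Q y (fscale c x) = fscale c (act Q y x)"
  by (rule poly_mapping_eqI)
    (auto simp: lookup_act comult_fscale lookup_map pairing_fscale_left)

lemma act_sum_right: "act Q y (sum f A) = (\<Sum>a\<in>A. act Q y (f a))"
  by (induction A rule: infinite_finite_induct) (auto simp: act_add_right)

lemma lookup_act_single:
  "lookup (act Q (single q c) x) p = (if composable Q p q then lookup x (pconcat p q) * c else 0)"
  by (simp add: lookup_act lookup_slice)

lemma act_in_path_space: "act Q y x \<in> path_space Q"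
  by (auto simp: path_space_def in_keys_iff lookup_act)
    (metis pairing_zero_left slice_eq_0_if_not_path)

text \<open>The action is the transpose of right multiplication.\<close>

lemma pairing_path_mult:
  assumes "y \<in> path_space Q" "z \<in> path_space Q"
  shows "pairing x (path_mult Q y z) = pairing (act Q z x) y"
proof -
  have "pairing x (path_mult Q y z) = (\<Sum>p\<in>keys y. \<Sum>q\<in>keys z.
      if psource q = ptarget Q p then lookup x (pconcat p q) * (lookup y p * lookup z q) else 0)"
    unfolding path_mult_def pairing_sum_right by (intro sum.cong refl) auto
  also have "\<dots> = (\<Sum>p\<in>keys y. \<Sum>q\<in>keys z. lookup y p * (lookup z q * lookup (slice Q x p) q))"
    using assms
    by (intro sum.cong refl) (auto simp: lookup_slice composable_def path_space_def)
  also have "\<dots> = (\<Sum>p\<in>keys y. lookup y p * lookup (act Q z x) p)"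
    unfolding lookup_act
    by (subst pairing_commute) (simp only: pairing_def sum_distrib_left)
  also have "\<dots> = pairing (act Q z x) y"
    by (subst pairing_commute) (simp only: pairing_def)
  finally show ?thesis .
qed

text \<open>
  A consequence of the transpose formula: the coefficient at \<open>p\<close> of either side is the pairing of
  \<open>y z\<close> with the slice at \<open>p\<close>.
\<close>

lemma act_path_mult:
  assumes "y \<in> path_space Q" "z \<in> path_space Q"
  shows "act Q (path_mult Q y z) x = act Q y (act Q z x)"
  by (rule poly_mapping_eqI) (simp add: lookup_act pairing_path_mult[OF assms] slice_act)

section \<open>The coalgebra of a quiver with relations\<close>

lemma two_sided_idealD:
  assumes "two_sided_ideal Q \<Omega>"
  shows "\<Omega> \<subseteq> path_space Q" "fs.subspace \<Omega>"
    "y \<in> \<Omega> \<Longrightarrow> z \<in> path_space Q \<Longrightarrow> path_mult Q y z \<in> \<Omega>"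
    "y \<in> \<Omega> \<Longrightarrow> z \<in> path_space Q \<Longrightarrow> path_mult Q z y \<in> \<Omega>"
  using assms by (auto simp: two_sided_ideal_def)

lemma single_in_path_space: "p \<in> paths Q \<Longrightarrow> single p c \<in> path_space Q"
  by (auto simp: path_space_def)

lemma subspace_path_space: "fs.subspace (path_space Q)"
  unfolding path_space_def by (rule subspace_support)

lemma subspace_path_coalgebra:
  fixes \<Omega> :: "(('v, 'a) qpath \<Rightarrow>\<^sub>0 'k::field) set"
  shows "fs.subspace (path_coalgebra Q \<Omega>)"
proof (rule fs.subspaceI)
  fix x y :: "('v, 'a) qpath \<Rightarrow>\<^sub>0 'k" and c
  show "0 \<in> path_coalgebra Q \<Omega>"
    by (simp add: path_coalgebra_def fs.subspace_0[OF subspace_path_space])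
  show "x + y \<in> path_coalgebra Q \<Omega>" if "x \<in> path_coalgebra Q \<Omega>" "y \<in> path_coalgebra Q \<Omega>"
    using that
    by (simp add: path_coalgebra_def fs.subspace_add[OF subspace_path_space] pairing_add_left)
  show "fscale c x \<in> path_coalgebra Q \<Omega>" if "x \<in> path_coalgebra Q \<Omega>"
    using that
    by (simp add: path_coalgebra_def fs.subspace_scale[OF subspace_path_space]
        pairing_fscale_left)
qed

text \<open>
  Transposing turns the fact that \<open>\<Omega>\<close> is a right ideal into stability of \<open>C\<close> under the action, and
  the fact that it is a left ideal into stability under slices (the next lemma).
\<close>

lemma act_in_path_coalgebra:
  assumes "two_sided_ideal Q \<Omega>" "x \<in> path_coalgebra Q \<Omega>" "y \<in> path_space Q"
  shows "act Q y x \<in> path_coalgebra Q \<Omega>"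
proof -
  have "pairing (act Q y x) z = 0" if "z \<in> \<Omega>" for z
    using assms that two_sided_idealD[OF assms(1)] pairing_path_mult[of z Q y x]
    by (auto simp: path_coalgebra_def)
  then show ?thesis by (simp add: path_coalgebra_def act_in_path_space)
qed

lemma slice_in_path_coalgebra:
  assumes "two_sided_ideal Q \<Omega>" "x \<in> path_coalgebra Q \<Omega>"
  shows "slice Q x p \<in> path_coalgebra Q \<Omega>"
proof (cases "p \<in> paths Q")
  case True
  have "pairing (slice Q x p) z = 0" if "z \<in> \<Omega>" for z
  proof -
    have "pairing (slice Q x p) z = pairing (act Q z x) (single p 1)"
      by (simp add: lookup_act)
    also have "\<dots> = pairing x (path_mult Q (single p 1) z)"
      using that two_sided_idealD(1)[OF assms(1)] True
      by (subst pairing_path_mult) (auto simp: single_in_path_space)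
    also have "\<dots> = 0"
      using that two_sided_idealD(4)[OF assms(1)] True assms(2)
      by (auto simp: path_coalgebra_def single_in_path_space)
    finally show ?thesis .
  qed
  then show ?thesis by (simp add: path_coalgebra_def slice_in_path_space)
next
  case False
  then show ?thesis
    by (simp add: slice_eq_0_if_not_path fs.subspace_0[OF subspace_path_coalgebra])
qed

lemma act_ideal_eq_0:
  assumes "two_sided_ideal Q \<Omega>" "x \<in> path_coalgebra Q \<Omega>" "y \<in> \<Omega>"
  shows "act Q y x = 0"
  using slice_in_path_coalgebra[OF assms(1,2)] assms(3)
  by (intro poly_mapping_eqI) (auto simp: lookup_act path_coalgebra_def)

text \<open>
  Conversely, membership in the coalgebra can be tested by the action: \<open>\<langle>x, y\<rangle>\<close> is the sum of the
  coefficients of \<open>y x\<close> at the trivial paths, because \<open>x\<close> is the sum of its slices at these.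
\<close>

lemma path_coalgebraI_act:
  assumes "x \<in> path_space Q" "\<And>y. y \<in> \<Omega> \<Longrightarrow> act Q y x = 0"
  shows "x \<in> path_coalgebra Q \<Omega>"
proof -
  have "pairing x y = 0" if "y \<in> \<Omega>" for y
  proof -
    have "pairing x y
      = pairing (\<Sum>p\<in>keys (comult Q x). fscale (path_counit p) (slice Q x p)) y"
      by (simp add: sum_slices_counit assms(1))
    also have "\<dots> = (\<Sum>p\<in>keys (comult Q x). path_counit p * lookup (act Q y x) p)"
      by (simp add: pairing_sum_left pairing_fscale_left lookup_act)
    finally show ?thesis using assms(2)[OF that] by simp
  qed
  then show ?thesis using assms(1) by (simp add: path_coalgebra_def)
qed

text \<open>
  Expand the second factors in a basis of their span: the coefficients of a basis vector form an
  element of \<open>CQ\<close>, and its pairing with an element of \<open>\<Omega>\<close> is a coordinate of 0. So this element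
  lies in \<open>C\<close>.
\<close>

lemma tensor_path_coalgebraI:
  fixes s :: "'k::field \<Rightarrow> 'w \<Rightarrow> 'w::ab_group_add"
    and z :: "('v, 'a) qpath \<Rightarrow>\<^sub>0 'w"
  assumes s: "vector_space s"
    and M: "\<And>p. lookup z p \<in> M"
    and z: "keys z \<subseteq> paths Q"
    and \<Omega>: "\<And>y. y \<in> \<Omega> \<Longrightarrow> (\<Sum>p\<in>keys z. s (lookup y p) (lookup z p)) = 0"
  shows "z \<in> tensor s (path_coalgebra Q \<Omega>) M"
proof -
  interpret vector_space s by (rule s)
  interpret t: vector_space "\<lambda>c. Poly_Mapping.map (s c) :: (('v, 'a) qpath \<Rightarrow>\<^sub>0 'w) \<Rightarrow> _"
    by (rule vector_space_map[OF s])
  obtain B where B: "B \<subseteq> lookup z ` keys z" "independent B" "lookup z ` keys z \<subseteq> span B"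
    by (rule maximal_independent_subset)
  have finB: "finite B"
    using B(1) by (rule finite_subset) simp
  have spanB: "lookup z p \<in> span B" for p
    using B(3) by (cases "p \<in> keys z") (auto simp: in_keys_iff span_zero)
  define c where "c b = Poly_Mapping.map (\<lambda>w. representation B w b) z" for b
  have lookup_c: "lookup (c b) p = representation B (lookup z p) b" for b p
    by (simp add: c_def lookup_map representation_zero)
  have keys_c: "keys (c b) \<subseteq> keys z" for b
    by (auto simp: in_keys_iff lookup_c representation_zero)
  have "c b \<in> path_coalgebra Q \<Omega>" for b
  proof -
    have "pairing (c b) y = 0" if "y \<in> \<Omega>" for y
    proof -
      have "pairing (c b) y = (\<Sum>p\<in>keys z. lookup y p * representation B (lookup z p) b)"
        by (simp add: pairing_superset[OF _ keys_c] lookup_c mult.commute)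
      also have "\<dots> = representation B (\<Sum>p\<in>keys z. s (lookup y p) (lookup z p)) b"
        by (simp add: representation_sum representation_scale B(2) spanB span_scale)
      also have "\<dots> = 0"
        by (simp add: \<Omega> that representation_zero)
      finally show ?thesis .
    qed
    then show ?thesis
      using keys_c[of b] z by (auto simp: path_coalgebra_def path_space_def)
  qed
  moreover have "b \<in> M" if "b \<in> B" for b
    using that B(1) M by auto
  ultimately have "(\<Sum>b\<in>B. tensor_elt s (c b) b) \<in> tensor s (path_coalgebra Q \<Omega>) M"
    unfolding tensor_def by (intro t.span_sum t.span_base) blast
  also have "(\<Sum>b\<in>B. tensor_elt s (c b) b) = z"
    by (rule poly_mapping_eqI)
      (simp add: lookup_sum tensor_elt_def lookup_map lookup_c
        sum_representation_eq[OF B(2) spanB finB])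
  finally show ?thesis .
qed

text \<open>
  Applying \<open>y\<close> to the first factor of \<open>\<Delta>(x)\<close> gives an element with coefficients
  \<open>\<langle>x, y q\<rangle> = \<langle>q x, y\<rangle>\<close>. These vanish because \<open>y q\<close> lies in \<open>\<Omega>\<close> again.
\<close>

lemma sum_slices_ideal_eq_0:
  assumes "two_sided_ideal Q \<Omega>" "x \<in> path_coalgebra Q \<Omega>" "y \<in> \<Omega>"
    and A: "finite A" "keys (comult Q x) \<subseteq> A"
  shows "(\<Sum>p\<in>A. fscale (lookup y p) (slice Q x p)) = 0"
proof (rule poly_mapping_eqI)
  fix q
  have act: "lookup (act Q (single q 1) x) p = lookup (slice Q x p) q" for p
    by (simp add: lookup_act)
  have "keys (act Q (single q 1) x) \<subseteq> A"
  proof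
    fix p assume "p \<in> keys (act Q (single q 1) x)"
    then have "slice Q x p \<noteq> 0" by (auto simp: in_keys_iff act)
    then show "p \<in> A" using A(2) by (auto simp: in_keys_iff)
  qed
  then have *: "lookup (\<Sum>p\<in>A. fscale (lookup y p) (slice Q x p)) q
      = pairing (act Q (single q 1) x) y"
    by (simp add: pairing_superset[OF A(1)] lookup_sum act mult.commute)
  show "lookup (\<Sum>p\<in>A. fscale (lookup y p) (slice Q x p)) q = lookup 0 q"
  proof (cases "q \<in> paths Q")
    case True
    then show ?thesis
      using * assms(3) act_in_path_coalgebra[OF assms(1,2), of "single q 1"]
      by (simp add: single_in_path_space path_coalgebra_def)
  next
    case False
    then have "lookup (slice Q x p) q = 0" for p
      by (simp add: lookup_slice composable_def)
    then show ?thesis by (simp add: lookup_sum)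
  qed
qed

lemma comult_in_tensor:
  assumes "two_sided_ideal Q \<Omega>" "x \<in> path_coalgebra Q \<Omega>" "\<And>p. slice Q x p \<in> M"
  shows "comult Q x \<in> tensor fscale (path_coalgebra Q \<Omega>) M"
  by (rule tensor_path_coalgebraI[OF fs.vector_space_axioms assms(3) keys_comult])
    (simp add: sum_slices_ideal_eq_0[OF assms(1,2)])

lemma subcoalgebra_path_coalgebra:
  "two_sided_ideal Q \<Omega> \<Longrightarrow> subcoalgebra Q (path_coalgebra Q \<Omega>)"
  by (auto simp: subcoalgebra_def subspace_path_coalgebra
      intro!: comult_in_tensor slice_in_path_coalgebra)
    (auto simp: path_coalgebra_def)

section \<open>Comodules\<close>

text \<open>The element \<open>(\<Delta> \<otimes> id)(z)\<close>, in coordinates.\<close>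

lemma lookup_comult_tensor_id:
  fixes s :: "'k::field \<Rightarrow> 'w \<Rightarrow> 'w::ab_group_add" and z :: "('v, 'a) qpath \<Rightarrow>\<^sub>0 'w"
  assumes "vector_space s"
  shows "lookup (lookup (\<Sum>p\<in>keys z.
      Poly_Mapping.map (\<lambda>y. tensor_elt s y (lookup z p)) (comult Q (single p 1))) p') p''
    = (if composable Q p' p'' then lookup z (pconcat p' p'') else 0)"
proof -
  interpret vector_space s by fact
  have 0: "tensor_elt s 0 w = (0 :: ('v, 'a) qpath \<Rightarrow>\<^sub>0 'w)" for w
    by (rule poly_mapping_eqI) (simp add: tensor_elt_def lookup_map)
  have "lookup (lookup (\<Sum>p\<in>keys z.
      Poly_Mapping.map (\<lambda>y. tensor_elt s y (lookup z p)) (comult Q (single p 1))) p') p''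
    = (\<Sum>p\<in>keys z. s (lookup (slice Q (single p 1) p') p'') (lookup z p))"
    by (simp add: lookup_sum lookup_map 0) (simp add: tensor_elt_def lookup_map)
  also have "\<dots> = (\<Sum>p\<in>keys z. if pconcat p' p'' = p
      then if composable Q p' p'' then lookup z p else 0 else 0)"
    by (rule sum.cong) (auto simp: lookup_slice lookup_single when_def)
  also have "\<dots> = (if composable Q p' p'' then lookup z (pconcat p' p'') else 0)"
    by (subst sum.delta') (auto simp: in_keys_iff)
  finally show ?thesis .
qed

text \<open>
  The comodule laws are those of the path coalgebra, and closure under slices puts \<open>\<Delta>(M)\<close> into
  \<open>C \<otimes> M\<close>.
\<close>

lemma left_comodule_subspace:
  assumes "two_sided_ideal Q \<Omega>" "fs.subspace M" "M \<subseteq> path_coalgebra Q \<Omega>"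
    and "\<And>x p. x \<in> M \<Longrightarrow> slice Q x p \<in> M"
  shows "left_comodule Q (path_coalgebra Q \<Omega>) \<lparr>cspace = M, cscale = fscale, coact = comult Q\<rparr>"
  unfolding left_comodule_def comodule.simps linear_map_on_def
proof (intro conjI ballI allI)
  fix x assume x: "x \<in> M"
  show "(\<Sum>p\<in>keys (comult Q x).
      Poly_Mapping.map (\<lambda>y. tensor_elt fscale y (slice Q x p)) (comult Q (single p 1)))
    = Poly_Mapping.map (comult Q) (comult Q x)"
    by (intro poly_mapping_eqI)
      (simp add: lookup_comult_tensor_id[OF fs.vector_space_axioms] lookup_map slice_slice)
  show "(\<Sum>p\<in>keys (comult Q x). fscale (path_counit p) (slice Q x p)) = x"
    using x assms(3) by (intro sum_slices_counit) (auto simp: path_coalgebra_def)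
qed (use assms in \<open>auto intro: comult_in_tensor fs.vector_space_axioms subcoalgebra_path_coalgebra
    simp: comult_add comult_fscale\<close>)

lemma direct_sum_simps:
  "cspace (direct_sum I N) =
     {m. finite {i. m i \<noteq> 0} \<and> {i. m i \<noteq> 0} \<subseteq> I \<and> (\<forall>i\<in>I. m i \<in> cspace (N i))}"
  "cscale (direct_sum I N) c m i = cscale (N i) c (m i)"
  by (simp_all add: direct_sum_def)

lemma lookup_coact_direct_sum:
  fixes N :: "'i \<Rightarrow> (('v, 'a) qpath, 'k::field, ('v, 'a) qpath \<Rightarrow>\<^sub>0 'k) comodule"
  assumes N: "\<And>i. coact (N i) = comult Q" and "finite {i. m i \<noteq> 0}"
  shows "lookup (coact (direct_sum I N) m) p = (\<lambda>i. slice Q (m i) p)"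
proof
  fix j :: 'i
  have summand: "lookup (Poly_Mapping.map (\<lambda>v j. if j = i then v else 0) z) p j
      = (if j = i then lookup z p else 0)" for i and z :: "('v, 'a) qpath \<Rightarrow>\<^sub>0 ('v, 'a) qpath \<Rightarrow>\<^sub>0 'k"
    by (subst lookup_map) auto
  have "lookup (coact (direct_sum I N) m) p j
    = (\<Sum>i\<in>{i. m i \<noteq> 0}. if j = i then slice Q (m i) p else 0)"
    by (auto simp: direct_sum_def lookup_sum summand N sum_fun_apply intro!: sum.cong)
  also have "\<dots> = slice Q (m j) p"
    using assms(2) by (subst sum.delta') auto
  finally show "lookup (coact (direct_sum I N) m) p j = slice Q (m j) p" .
qed

text \<open>
  The comodule laws of a direct sum hold because, component by component, its coaction is \<open>\<Delta>\<close>.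
\<close>

lemma left_comodule_direct_sum:
  fixes N :: "'i \<Rightarrow> (('v, 'a) qpath, 'k::field, ('v, 'a) qpath \<Rightarrow>\<^sub>0 'k) comodule"
  assumes "two_sided_ideal Q \<Omega>"
    and N: "\<And>i. coact (N i) = comult Q" "\<And>i. cscale (N i) = fscale"
    and sub: "\<And>i. i \<in> I \<Longrightarrow> fs.subspace (cspace (N i))"
    and C: "\<And>i. i \<in> I \<Longrightarrow> cspace (N i) \<subseteq> path_coalgebra Q \<Omega>"
    and slice: "\<And>i x p. i \<in> I \<Longrightarrow> x \<in> cspace (N i) \<Longrightarrow> slice Q x p \<in> cspace (N i)"
  shows "left_comodule Q (path_coalgebra Q \<Omega>) (direct_sum I N)"
proof -
  let ?D = "direct_sum I N"
  let ?s = "cscale ?D"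
  let ?M = "cspace ?D"
  have scale: "?s = (\<lambda>c m i. fscale c (m i))"
    by (intro ext) (simp add: direct_sum_simps N(2))
  have vs: "vector_space ?s"
    unfolding scale
    by unfold_locales
      (auto simp: algebra_simps fs.scale_right_distrib fs.scale_left_distrib fun_eq_iff)
  then interpret vector_space ?s .
  have finM: "finite {i. m i \<noteq> 0}" if "m \<in> ?M" for m
    using that by (simp add: direct_sum_simps)
  have coact: "lookup (coact ?D m) p = (\<lambda>i. slice Q (m i) p)" if "m \<in> ?M" for m p
    using N(1) finM[OF that] by (rule lookup_coact_direct_sum)
  have CM: "m i \<in> path_coalgebra Q \<Omega>" if "m \<in> ?M" for m i
    using that C[of i] fs.subspace_0[OF subspace_path_coalgebra, of Q \<Omega>]
    by (cases "m i = 0") (auto simp: direct_sum_simps)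
  have subM: "subspace ?M"
  proof (rule subspaceI)
    show "0 \<in> ?M"
      by (simp add: direct_sum_simps fs.subspace_0 sub)
    fix m m' c assume m: "m \<in> ?M"
    show "?s c m \<in> ?M"
      using m finite_subset[of "{i. ?s c m i \<noteq> 0}" "{i. m i \<noteq> 0}"]
      by (auto simp: direct_sum_simps(1)) (auto simp: scale fs.subspace_scale sub)
    assume m': "m' \<in> ?M"
    have supp: "{i. (m + m') i \<noteq> 0} \<subseteq> {i. m i \<noteq> 0} \<union> {i. m' i \<noteq> 0}" by auto
    with finM[OF m] finM[OF m'] have "finite {i. (m + m') i \<noteq> 0}"
      by (meson finite_UnI finite_subset)
    moreover from supp m m' have "{i. (m + m') i \<noteq> 0} \<subseteq> I"
      unfolding direct_sum_simps(1) by blast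
    ultimately show "m + m' \<in> ?M"
      using m m' by (simp add: direct_sum_simps(1) fs.subspace_add sub)
  qed
  have sliceM: "(\<lambda>i. slice Q (m i) p) \<in> ?M" if m: "m \<in> ?M" for m p
  proof -
    have "{i. slice Q (m i) p \<noteq> 0} \<subseteq> {i. m i \<noteq> 0}" by auto
    with finM[OF m] have "finite {i. slice Q (m i) p \<noteq> 0}"
      by (rule rev_finite_subset)
    then show ?thesis using m by (auto simp: direct_sum_simps slice)
  qed
  have keys_coact: "keys (comult Q (m i)) \<subseteq> keys (coact ?D m)" if "m \<in> ?M" for m i
    by (auto simp: in_keys_iff coact[OF that] fun_eq_iff)
  show ?thesis
    unfolding left_comodule_def linear_map_on_def
  proof (intro conjI ballI allI subsetI vs subM)
    show "subcoalgebra Q (path_coalgebra Q \<Omega>)"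
      by (rule subcoalgebra_path_coalgebra) fact
  next
    fix m m' assume "m \<in> ?M" "m' \<in> ?M"
    then show "coact ?D (m + m') = coact ?D m + coact ?D m'"
      using subspace_add[OF subM, of m m']
      by (intro poly_mapping_eqI) (simp add: coact lookup_add comult_add fun_eq_iff)
  next
    fix c m assume "m \<in> ?M"
    then show "coact ?D (?s c m) = Poly_Mapping.map (?s c) (coact ?D m)"
      using subspace_scale[OF subM, of m c]
      by (intro poly_mapping_eqI)
        (simp add: coact lookup_map, simp add: scale comult_fscale lookup_map fun_eq_iff)
  next
    fix z assume "z \<in> coact ?D ` ?M"
    then obtain m where m: "m \<in> ?M" and z: "z = coact ?D m" by blast
    show "z \<in> tensor ?s (path_coalgebra Q \<Omega>) ?M"
      unfolding z
    proof (rule tensor_path_coalgebraI[OF vs])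
      show "lookup (coact ?D m) p \<in> ?M" for p
        by (simp add: coact m sliceM)
      show "keys (coact ?D m) \<subseteq> paths Q"
        by (auto simp: in_keys_iff coact m fun_eq_iff)
          (metis slice_eq_0_if_not_path)
      fix y assume "y \<in> \<Omega>"
      then show "(\<Sum>p\<in>keys (coact ?D m). ?s (lookup y p) (lookup (coact ?D m) p)) = 0"
        using m
        by (simp add: fun_eq_iff sum_fun_apply coact)
          (simp add: scale sum_slices_ideal_eq_0[OF assms(1) CM _ _ keys_coact])
    qed
  next
    fix m assume m: "m \<in> ?M"
    show "(\<Sum>p\<in>keys (coact ?D m).
        Poly_Mapping.map (\<lambda>y. tensor_elt ?s y (lookup (coact ?D m) p)) (comult Q (single p 1)))
      = Poly_Mapping.map (coact ?D) (coact ?D m)"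
    proof (intro poly_mapping_eqI)
      fix p q
      have "coact ?D 0 = 0"
        by (simp add: direct_sum_def)
      then show "lookup (lookup (\<Sum>p\<in>keys (coact ?D m).
          Poly_Mapping.map (\<lambda>y. tensor_elt ?s y (lookup (coact ?D m) p)) (comult Q (single p 1))) p) q
        = lookup (lookup (Poly_Mapping.map (coact ?D) (coact ?D m)) p) q"
        unfolding lookup_comult_tensor_id[OF vs] using m sliceM[OF m]
        by (simp add: lookup_map coact slice_slice fun_eq_iff)
    qed
    show "(\<Sum>p\<in>keys (coact ?D m). ?s (path_counit p) (lookup (coact ?D m) p)) = m"
      using m CM[OF m]
      by (simp add: fun_eq_iff sum_fun_apply coact)
        (simp add: scale sum_slices_counit[OF _ keys_coact] path_coalgebra_def)
  qed
qed

section \<open>The comodules at the vertices\<close>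

lemma keys_actE:
  assumes "p \<in> keys (act Q y x)"
  obtains q where "q \<in> keys y" "composable Q p q" "pconcat p q \<in> keys x"
proof -
  have "pairing (slice Q x p) y \<noteq> 0"
    using assms by (simp add: in_keys_iff lookup_act)
  then obtain q where "q \<in> keys (slice Q x p)" "q \<in> keys y"
    by (rule pairing_nonzeroE)
  then show ?thesis
    using that[of q] by (simp add: in_keys_iff lookup_slice split: if_splits)
qed

text \<open>
  The action of \<open>y\<close> only reads off terminal parts of the paths in \<open>x\<close>, and these keep the target.
\<close>

lemma act_eq_0_if_targets_differ:
  assumes "\<And>p. p \<in> keys x \<Longrightarrow> ptarget Q p = n" "\<And>q. q \<in> keys y \<Longrightarrow> ptarget Q q \<noteq> n"
  shows "act Q y x = 0"
proof -
  have "p \<notin> keys (act Q y x)" for p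
  proof
    assume "p \<in> keys (act Q y x)"
    then obtain q where "q \<in> keys y" "composable Q p q" "pconcat p q \<in> keys x"
      by (rule keys_actE)
    then show False
      using assms(1)[of "pconcat p q"] assms(2)[of q] by (simp add: composable_def ptarget_pconcat)
  qed
  then show ?thesis by (intro poly_mapping_eqI) (simp add: in_keys_iff)
qed

lemma act_vertex:
  assumes "wf_digraph Q" "x \<in> path_space Q"
  shows "lookup (act Q (single (i, []) c) x) p = (if ptarget Q p = i then lookup x p * c else 0)"
  using assms by (auto simp: lookup_act_single composable_trivial_right path_space_def in_keys_iff)

text \<open>
  The idempotent \<open>e\<^sub>i\<close> is the projection onto the span of the paths with target \<open>i\<close>.
\<close>

lemma vertex_comodule_eq:
  assumes "wf_digraph Q" "two_sided_ideal Q \<Omega>"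
  shows "vertex_comodule Q (path_coalgebra Q \<Omega>) i =
    \<lparr>cspace = {x \<in> path_coalgebra Q \<Omega>. \<forall>p\<in>keys x. ptarget Q p = i},
     cscale = fscale, coact = comult Q\<rparr>"
proof -
  let ?C = "path_coalgebra Q \<Omega>"
  have CP: "x \<in> path_space Q" if "x \<in> ?C" for x
    using that by (simp add: path_coalgebra_def)
  have "act Q (single (i, []) 1) x \<in> {x \<in> ?C. \<forall>p\<in>keys x. ptarget Q p = i}" if "x \<in> ?C" for x
  proof -
    \<comment> \<open>If \<open>i\<close> is not a vertex, then \<open>(i, [])\<close> is not a path, and it acts as 0.\<close>
    have "act Q (single (i, []) 1) x \<in> ?C"
    proof (cases "i \<in> verts Q")
      case True
      then show ?thesis
        using assms(2) that
        by (intro act_in_path_coalgebra single_in_path_space) (auto simp: trivial_in_paths_iff)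
    next
      case False
      then have "act Q (single (i, []) 1) x = 0"
        by (intro poly_mapping_eqI)
          (auto simp: lookup_act_single composable_def trivial_in_paths_iff)
      then show ?thesis by (simp add: fs.subspace_0[OF subspace_path_coalgebra])
    qed
    then show ?thesis
      by (auto simp: in_keys_iff act_vertex[OF assms(1) CP[OF that]] split: if_splits)
  qed
  moreover have "x = act Q (single (i, []) 1) x" if "x \<in> ?C" "\<forall>p\<in>keys x. ptarget Q p = i" for x
    by (rule poly_mapping_eqI)
      (use that in \<open>auto simp: act_vertex[OF assms(1) CP] in_keys_iff\<close>)
  ultimately have "act Q (single (i, []) 1) ` ?C = {x \<in> ?C. \<forall>p\<in>keys x. ptarget Q p = i}"
    by blast
  then show ?thesis by (simp add: vertex_comodule_def)
qed

lemma act_in_vertex_comodule: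
  assumes "wf_digraph Q" "two_sided_ideal Q \<Omega>" "x \<in> path_coalgebra Q \<Omega>" "y \<in> path_space Q"
    and "\<And>q. q \<in> keys y \<Longrightarrow> psource q = i"
  shows "act Q y x \<in> cspace (vertex_comodule Q (path_coalgebra Q \<Omega>) i)"
  using act_in_path_coalgebra[OF assms(2-4)] assms(5)
  by (auto simp: vertex_comodule_eq[OF assms(1,2)] composable_def elim!: keys_actE)

lemma vertex_comodule_slice_closed:
  assumes "wf_digraph Q" "two_sided_ideal Q \<Omega>"
  shows "fs.subspace (cspace (vertex_comodule Q (path_coalgebra Q \<Omega>) i))"
    and "x \<in> cspace (vertex_comodule Q (path_coalgebra Q \<Omega>) i) \<Longrightarrow>
      slice Q x p \<in> cspace (vertex_comodule Q (path_coalgebra Q \<Omega>) i)"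
proof -
  let ?C = "path_coalgebra Q \<Omega>"
  have "cspace (vertex_comodule Q ?C i) = ?C \<inter> {x. keys x \<subseteq> {p. ptarget Q p = i}}"
    by (auto simp: vertex_comodule_eq[OF assms])
  then show "fs.subspace (cspace (vertex_comodule Q ?C i))"
    using fs.subspace_inter[OF subspace_path_coalgebra subspace_support] by simp
  assume x: "x \<in> cspace (vertex_comodule Q ?C i)"
  have "ptarget Q q = i" if "q \<in> keys (slice Q x p)" for q
  proof -
    have "composable Q p q" "pconcat p q \<in> keys x"
      using that by (auto simp: in_keys_iff lookup_slice split: if_splits)
    then show ?thesis
      using x by (auto simp: vertex_comodule_eq[OF assms] composable_def ptarget_pconcat)
  qed
  then show "slice Q x p \<in> cspace (vertex_comodule Q ?C i)"
    using x by (simp add: vertex_comodule_eq[OF assms] slice_in_path_coalgebra[OF assms(2)])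
qed

lemma vertex_comodule_simps [simp]:
  "cscale (vertex_comodule Q C i) = fscale" "coact (vertex_comodule Q C i) = comult Q"
  by (simp_all add: vertex_comodule_def)

lemma in_vertex_comoduleD:
  assumes "wf_digraph Q" "two_sided_ideal Q \<Omega>"
    and "x \<in> cspace (vertex_comodule Q (path_coalgebra Q \<Omega>) i)"
  shows "x \<in> path_coalgebra Q \<Omega>" "x \<in> path_space Q" "\<And>p. p \<in> keys x \<Longrightarrow> ptarget Q p = i"
  using assms(3) unfolding vertex_comodule_eq[OF assms(1,2)] by (auto simp: path_coalgebra_def)

lemma left_comodule_vertex:
  assumes "wf_digraph Q" "two_sided_ideal Q \<Omega>"
  shows "left_comodule Q (path_coalgebra Q \<Omega>) (vertex_comodule Q (path_coalgebra Q \<Omega>) i)"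
proof -
  have "left_comodule Q (path_coalgebra Q \<Omega>)
    \<lparr>cspace = cspace (vertex_comodule Q (path_coalgebra Q \<Omega>) i), cscale = fscale, coact = comult Q\<rparr>"
    using in_vertex_comoduleD(1)[OF assms] vertex_comodule_slice_closed[OF assms]
    by (intro left_comodule_subspace assms(2)) auto
  then show ?thesis by (simp add: vertex_comodule_def)
qed

lemma left_comodule_direct_sum_vertex:
  assumes "wf_digraph Q" "two_sided_ideal Q \<Omega>"
  shows "left_comodule Q (path_coalgebra Q \<Omega>)
    (direct_sum I (\<lambda>j. vertex_comodule Q (path_coalgebra Q \<Omega>) (h j)))"
  using in_vertex_comoduleD(1)[OF assms] vertex_comodule_slice_closed[OF assms]
  by (intro left_comodule_direct_sum assms(2)) auto

lemma simple_comodule_eq: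
  "(simple_comodule Q n :: (('v, 'a) qpath, 'k::field, _) comodule)
    = \<lparr>cspace = {x. keys x \<subseteq> {(n, [])}}, cscale = fscale, coact = comult Q\<rparr>"
proof -
  have "x = fscale (lookup x (n, [])) (single (n, []) 1)" if "keys x \<subseteq> {(n, [])}"
    for x :: "('v, 'a) qpath \<Rightarrow>\<^sub>0 'k"
    using that by (intro poly_mapping_eqI) (auto simp: lookup_single when_def in_keys_iff)
  then have "fs.span {single (n, []) (1 :: 'k)} = {x :: ('v, 'a) qpath \<Rightarrow>\<^sub>0 'k. keys x \<subseteq> {(n, [])}}"
    by (auto simp: fs.span_singleton in_keys_iff lookup_single when_def
        split: if_splits intro!: image_eqI)
  then show ?thesis by (simp add: simple_comodule_def)
qed

section \<open>The maps of the sequence\<close>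

lemma lookup_strip_arrow: "lookup (strip_arrow x a) q = lookup x (fst q, snd q @ [a])"
proof -
  have *: "lookup (if snd p \<noteq> [] \<and> last (snd p) = a
      then single (fst p, butlast (snd p)) (lookup x p) else 0) q
    = (if (fst q, snd q @ [a]) = p then lookup x p else 0)" for p
    by (cases p; cases q; cases "snd p" rule: rev_cases) (auto simp: lookup_single when_def)
  show ?thesis
    unfolding strip_arrow_def lookup_sum *
    by (subst sum.delta') (auto simp: in_keys_iff)
qed

lemma strip_arrow_sum: "strip_arrow (sum f A) a = (\<Sum>i\<in>A. strip_arrow (f i) a)"
  by (rule poly_mapping_eqI) (simp add: lookup_strip_arrow lookup_sum)

lemma strip_arrow_in_path_space: "y \<in> path_space Q \<Longrightarrow> strip_arrow y a \<in> path_space Q"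
  using butlast_in_paths
  by (fastforce simp: path_space_def lookup_strip_arrow in_keys_iff subset_iff)

lemma path_mult_single:
  "composable Q p q \<Longrightarrow> path_mult Q (single p c) (single q 1) = single (pconcat p q) c"
  by (simp add: path_mult_def composable_def)

text \<open>The action of a path peels off its arrows one at a time, starting with the last.\<close>

lemma act_single_snoc:
  assumes "wf_digraph Q" "(i, as @ [a]) \<in> paths Q"
  shows "act Q (single (i, as @ [a]) c) x
    = act Q (single (i, as) c) (act Q (single (arrow_path Q a) 1) x)"
proof -
  note comp = snoc_path(1)[OF assms]
  have "single (i, as @ [a]) c = path_mult Q (single (i, as) c) (single (arrow_path Q a) 1)"
    using path_mult_single[OF comp, of c] by (simp add: pconcat_arrow)
  then show ?thesis
    using comp by (simp add: act_path_mult single_in_path_space composable_def)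
qed

text \<open>
  An element without trivial paths is the sum of the products \<open>(y a\<^sup>-\<^sup>1) a\<close>. Only the finitely many
  arrows that do not annihilate \<open>x\<close> contribute to its action on \<open>x\<close>.
\<close>

lemma act_eq_sum_strip_arrow:
  assumes "wf_digraph Q" "y \<in> path_space Q" "\<And>p. p \<in> keys y \<Longrightarrow> snd p \<noteq> []"
    and A: "finite A" "\<And>a. a \<in> arcs Q \<Longrightarrow> a \<notin> A \<Longrightarrow> act Q (single (arrow_path Q a) 1) x = 0"
  shows "act Q y x = (\<Sum>a\<in>A. act Q (strip_arrow y a) (act Q (single (arrow_path Q a) 1) x))"
proof -
  have path: "act Q (single p c) x
      = (\<Sum>a\<in>A. act Q (strip_arrow (single p c) a) (act Q (single (arrow_path Q a) 1) x))"
    if p: "p \<in> keys y" for p c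
  proof -
    obtain i as b where ib: "p = (i, as @ [b])"
      using assms(3)[OF p] by (metis prod.collapse rev_exhaust)
    then have path: "(i, as @ [b]) \<in> paths Q"
      using p assms(2) by (auto simp: path_space_def)
    have "strip_arrow (single p c) a = (if b = a then single (i, as) c else 0)" for a
      by (rule poly_mapping_eqI) (auto simp: lookup_strip_arrow ib lookup_single when_def)
    then have "(\<Sum>a\<in>A. act Q (strip_arrow (single p c) a) (act Q (single (arrow_path Q a) 1) x))
      = (\<Sum>a\<in>A. if b = a then act Q (single (i, as) c) (act Q (single (arrow_path Q b) 1) x) else 0)"
      by (intro sum.cong) auto
    also have "\<dots> = act Q (single (i, as) c) (act Q (single (arrow_path Q b) 1) x)"
      using A snoc_path(2)[OF assms(1) path] by (subst sum.delta') auto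
    also have "\<dots> = act Q (single p c) x"
      unfolding ib by (rule act_single_snoc[OF assms(1) path, symmetric])
    finally show ?thesis by simp
  qed
  have "act Q y x = (\<Sum>p\<in>keys y. act Q (single p (lookup y p)) x)"
    by (simp flip: act_sum_left add: sum_single_keys)
  also have "\<dots> = (\<Sum>a\<in>A. \<Sum>p\<in>keys y.
      act Q (strip_arrow (single p (lookup y p)) a) (act Q (single (arrow_path Q a) 1) x))"
    by (subst sum.swap) (simp add: path)
  also have "\<dots> = (\<Sum>a\<in>A. act Q (strip_arrow y a) (act Q (single (arrow_path Q a) 1) x))"
    by (simp flip: act_sum_left strip_arrow_sum add: sum_single_keys)
  finally show ?thesis .
qed

lemma map_f_apply:
  "map_f Q n x a = (if a \<in> arrows_into Q n then act Q (single (arrow_path Q a) 1) x else 0)"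
  by (simp add: map_f_def)

text \<open>
  As \<open>r a\<^sup>-\<^sup>1\<close> vanishes unless \<open>a\<close> is a leading arrow of a relation into \<open>n\<close>, both cases in the
  definition of \<open>g\<close> are given by one formula.
\<close>

lemma map_g_apply:
  fixes R :: "(('v, 'a) qpath \<Rightarrow>\<^sub>0 'k::field) set"
  shows "map_g Q R n m r = (if r \<in> relations_into Q R n
     then \<Sum>a\<in>{a. m a \<noteq> 0}. act Q (strip_arrow r a) (m a) else 0)"
proof -
  have "strip_arrow r a = 0" if "r \<in> relations_into Q R n" "a \<notin> lead (relations_into Q R n)" for a
  proof (rule poly_mapping_eqI)
    fix q :: "('v, 'a) qpath"
    have "a \<in> path_lead (fst q, snd q @ [a])"
      by (simp add: path_lead_def)
    then have "(fst q, snd q @ [a]) \<notin> keys r"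
      using that by (auto simp: lead_def)
    then show "lookup (strip_arrow r a) q = lookup 0 q"
      by (simp add: lookup_strip_arrow in_keys_iff)
  qed
  then show ?thesis
    unfolding map_g_def sum_fun_apply by (auto simp: map_g_summand_def intro!: sum.cong sum.neutral)
qed

lemma finite_support_map_f: "finite {a. map_f Q n x a \<noteq> 0}"
proof (rule finite_subset)
  show "{a. map_f Q n x a \<noteq> 0} \<subseteq> (\<lambda>p. last (snd p)) ` keys x"
  proof
    fix a assume "a \<in> {a. map_f Q n x a \<noteq> 0}"
    then have "act Q (single (arrow_path Q a) 1) x \<noteq> 0"
      by (auto simp: map_f_apply split: if_splits)
    then obtain p where "p \<in> keys (act Q (single (arrow_path Q a) 1) x)"
      by (metis in_keys_iff lookup_zero poly_mapping_eqI)
    then have "pconcat p (arrow_path Q a) \<in> keys x"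
      by (auto elim!: keys_actE split: if_splits)
    then show "a \<in> (\<lambda>p. last (snd p)) ` keys x"
      by (force simp: pconcat_arrow)
  qed
qed simp

text \<open>The composition \<open>g \<circ> f\<close> is the action of the relations: \<open>r\<close> is the sum of all \<open>(r a\<^sup>-\<^sup>1) a\<close>.\<close>

lemma map_g_map_f:
  assumes "wf_digraph Q" "\<And>p. p \<in> keys x \<Longrightarrow> ptarget Q p = n"
    and r: "r \<in> relations_into Q R n" "r \<in> path_space Q" "\<And>p. p \<in> keys r \<Longrightarrow> snd p \<noteq> []"
  shows "map_g Q R n (map_f Q n x) r = act Q r x"
proof -
  let ?A = "{a. map_f Q n x a \<noteq> 0}"
  have "act Q r x = (\<Sum>a\<in>?A. act Q (strip_arrow r a) (act Q (single (arrow_path Q a) 1) x))"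
  proof (rule act_eq_sum_strip_arrow[OF assms(1) r(2,3) finite_support_map_f])
    fix a assume "a \<in> arcs Q" "a \<notin> ?A"
    then show "act Q (single (arrow_path Q a) 1) x = 0"
      using act_eq_0_if_targets_differ[of x Q n "single (arrow_path Q a) 1"] assms(2)
      by (cases "head Q a = n") (auto simp: map_f_apply arrows_into_def)
  qed
  also have "\<dots> = (\<Sum>a\<in>?A. act Q (strip_arrow r a) (map_f Q n x a))"
    by (rule sum.cong) (auto simp: map_f_apply)
  finally show ?thesis using r(1) by (simp add: map_g_apply)
qed

text \<open>
  Without the relations, every family is in the image of \<open>f\<close>: append to the component at \<open>a\<close> the
  arrow \<open>a\<close> and add up.
\<close>

lemma map_f_preimage:
  assumes "wf_digraph Q" and m: "finite {a. m a \<noteq> 0}" "{a. m a \<noteq> 0} \<subseteq> arrows_into Q n"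
    and path: "\<And>a. m a \<in> path_space Q"
    and target: "\<And>a p. p \<in> keys (m a) \<Longrightarrow> ptarget Q p = tail Q a"
  obtains x where "x \<in> path_space Q" "\<And>p. p \<in> keys x \<Longrightarrow> ptarget Q p = n" "map_f Q n x = m"
proof -
  define x where
    "x = (\<Sum>a\<in>{a. m a \<noteq> 0}. \<Sum>p\<in>keys (m a). single (fst p, snd p @ [a]) (lookup (m a) p))"
  have nil: "lookup x (i, []) = 0" for i
    by (simp add: x_def lookup_sum lookup_single when_def)
  have snoc: "lookup x (i, as @ [b]) = lookup (m b) (i, as)" for i as b
  proof -
    have *: "lookup (single (fst p, snd p @ [a]) c) (i, as @ [b])
        = (if (i, as) = p then if b = a then c else 0 else 0)" for p a c
      by (cases p) (auto simp: lookup_single when_def)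
    have "(\<Sum>p\<in>keys (m a). lookup (single (fst p, snd p @ [a]) (lookup (m a) p)) (i, as @ [b]))
        = (if b = a then lookup (m b) (i, as) else 0)" for a
      unfolding * by (subst sum.delta') (auto simp: in_keys_iff)
    then have "lookup x (i, as @ [b])
        = (\<Sum>a\<in>{a. m a \<noteq> 0}. if b = a then lookup (m b) (i, as) else 0)"
      by (simp add: x_def lookup_sum)
    then show ?thesis
      using m(1) by (subst (asm) sum.delta') auto
  qed
  have key: "p \<in> paths Q \<and> ptarget Q p = n" if "p \<in> keys x" for p
  proof -
    obtain i as where p: "p = (i, as)" by (cases p)
    with that nil obtain as' b where b: "p = (i, as' @ [b])"
      by (cases as rule: rev_cases) (auto simp: in_keys_iff)
    with that have q: "(i, as') \<in> keys (m b)" by (simp add: in_keys_iff snoc)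
    then have "m b \<noteq> 0" by auto
    with m(2) have ab: "b \<in> arcs Q" "head Q b = n" by (auto simp: arrows_into_def)
    have "(i, as') \<in> paths Q" using q path by (auto simp: path_space_def)
    with q target ab have "composable Q (i, as') (arrow_path Q b)"
      by (simp add: composable_arrow[OF assms(1)])
    from pconcat_in_paths[OF this] show ?thesis
      using b ab by (simp add: pconcat_arrow ptarget_conv)
  qed
  have "map_f Q n x = m"
  proof
    fix b
    show "map_f Q n x b = m b"
    proof (cases "b \<in> arrows_into Q n")
      case True
      then have b: "b \<in> arcs Q" by (simp add: arrows_into_def)
      show ?thesis
      proof (rule poly_mapping_eqI)
        fix p
        have "lookup (m b) p = 0" if "\<not> (p \<in> paths Q \<and> ptarget Q p = tail Q b)"
          using that path[of b] target[of p b] by (auto simp: path_space_def in_keys_iff)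
        then show "lookup (map_f Q n x b) p = lookup (m b) p"
          using True
          by (auto simp: map_f_apply lookup_act_single composable_arrow[OF assms(1) b]
              pconcat_arrow snoc)
      qed
    next
      case False
      with m(2) show ?thesis by (auto simp: map_f_apply)
    qed
  qed
  moreover have "x \<in> path_space Q" using key by (auto simp: path_space_def)
  ultimately show ?thesis using that key by blast
qed

text \<open>
  The coefficient of \<open>x\<close> at a nontrivial path \<open>p a\<close> is the coefficient of \<open>\<iota>(a) x\<close> at \<open>p\<close>, so \<open>f\<close>
  forgets nothing but the trivial path at \<open>n\<close>.
\<close>

lemma map_f_eq_0_iff:
  assumes "wf_digraph Q" "x \<in> path_space Q" "\<And>p. p \<in> keys x \<Longrightarrow> ptarget Q p = n"
  shows "map_f Q n x = 0 \<longleftrightarrow> keys x \<subseteq> {(n, [])}"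
proof
  assume f: "map_f Q n x = 0"
  show "keys x \<subseteq> {(n, [])}"
  proof
    fix p assume p: "p \<in> keys x"
    obtain i as where ias: "p = (i, as)" by (cases p)
    show "p \<in> {(n, [])}"
    proof (cases as rule: rev_cases)
      case Nil
      then show ?thesis using assms(3)[OF p] ias by (simp add: ptarget_conv)
    next
      case (snoc as' b)
      have "p \<in> paths Q" using p assms(2) by (auto simp: path_space_def)
      then have comp: "composable Q (i, as') (arrow_path Q b)" and "b \<in> arcs Q"
        using snoc_path[OF assms(1), of i as' b] ias snoc by auto
      then have "b \<in> arrows_into Q n"
        using assms(3)[OF p] ias snoc by (simp add: arrows_into_def ptarget_conv)
      then have "lookup (map_f Q n x b) (i, as') = lookup x p"
        using comp ias snoc by (simp add: map_f_apply lookup_act_single pconcat_arrow)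
      then show ?thesis using f p by (simp add: in_keys_iff)
    qed
  qed
next
  assume "keys x \<subseteq> {(n, [])}"
  then have "lookup x (pconcat p (arrow_path Q a)) = 0" for p a
    by (auto simp: pconcat_arrow in_keys_iff)
  then show "map_f Q n x = 0"
    by (intro ext poly_mapping_eqI) (simp add: map_f_apply lookup_act_single)
qed

section \<open>Relations and exactness\<close>

lemma relation_keys_length:
  fixes \<Omega> :: "(('v, 'a) qpath \<Rightarrow>\<^sub>0 'k::field) set"
  assumes "quiver_with_relations Q \<Omega>" "y \<in> \<Omega>" "p \<in> keys y"
  shows "2 \<le> length (snd p)"
proof -
  have "path_space_ge Q 2 \<subseteq> {y :: ('v, 'a) qpath \<Rightarrow>\<^sub>0 'k. keys y \<subseteq> {p. 2 \<le> length (snd p)}}"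
    unfolding path_space_ge_def by (rule fs.span_minimal[OF _ subspace_support]) auto
  then show ?thesis using assms by (auto simp: quiver_with_relations_def)
qed

text \<open>
  Every ideal contains 0, so removing 0 from a generating set leaves a generating set.
\<close>

lemma minimal_relations_nonzero:
  fixes \<Omega> R :: "(('v, 'a) qpath \<Rightarrow>\<^sub>0 'k::field) set"
  assumes "minimal_relations Q \<Omega> R"
  shows "0 \<notin> R"
proof
  assume "0 \<in> R"
  have "R \<subseteq> I \<longleftrightarrow> R - {0} \<subseteq> I" if "two_sided_ideal Q I" for I
    using fs.subspace_0[OF two_sided_idealD(2)[OF that]] by auto
  then have "generated_ideal Q (R - {0}) = generated_ideal Q R"
    unfolding generated_ideal_def by (metis (no_types, lifting))
  with \<open>0 \<in> R\<close> assms show False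
    unfolding minimal_relations_def by (metis Diff_subset insert_Diff_single insert_absorb
        Diff_iff insertI1 psubsetI)
qed

lemma relation_ends:
  fixes Q :: "('v, 'a) pre_digraph"
  assumes "minimal_relations Q \<Omega> R" "r \<in> R"
  shows "p \<in> keys r \<Longrightarrow> psource p = rsource r" "p \<in> keys r \<Longrightarrow> ptarget Q p = rtarget Q r"
    "rsource r \<in> verts Q" "rtarget Q r \<in> verts Q"
proof -
  obtain i j where ij: "i \<in> verts Q" "j \<in> verts Q"
    "\<And>p. p \<in> keys r \<Longrightarrow> psource p = i \<and> ptarget Q p = j"
    using assms by (auto simp: minimal_relations_def)
  have "r \<noteq> 0" using minimal_relations_nonzero[OF assms(1)] assms(2) by auto
  then obtain p0 where p0: "p0 \<in> keys r" by (metis all_not_in_conv keys_eq_empty)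
  \<comment> \<open>As \<open>r\<close> contains a path, the value shared by all of its paths is determined.\<close>
  have common: "(THE v. \<forall>p\<in>keys r. h p = v) = w" if "\<And>p. p \<in> keys r \<Longrightarrow> h p = w"
    for h :: "_ \<Rightarrow> 'v" and w
  proof (rule the_equality)
    show "\<forall>p\<in>keys r. h p = w" using that by blast
    fix v assume "\<forall>p\<in>keys r. h p = v"
    then have "h p0 = v" using p0 by (rule bspec)
    then show "v = w" using that[OF p0] by simp
  qed
  have "rsource r = i"
    unfolding rsource_def by (rule common) (simp add: ij(3))
  moreover have "rtarget Q r = j"
    unfolding rtarget_def by (rule common) (simp add: ij(3))
  ultimately show "p \<in> keys r \<Longrightarrow> psource p = rsource r" "p \<in> keys r \<Longrightarrow> ptarget Q p = rtarget Q r"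
    "rsource r \<in> verts Q" "rtarget Q r \<in> verts Q" using ij by auto
qed

text \<open>
  The elements of \<open>\<Omega>\<close> that annihilate \<open>x\<close> form an ideal as soon as every arrow sends \<open>x\<close> into the
  coalgebra \<open>C\<close>: acting on \<open>x\<close> by a path then gives a multiple of \<open>x\<close> or an element of \<open>C\<close>,
  and \<open>\<Omega>\<close> annihilates \<open>C\<close>. Hence it suffices to test the relations that generate \<open>\<Omega>\<close>.
\<close>

lemma path_coalgebraI_relations:
  fixes \<Omega> R :: "(('v, 'a) qpath \<Rightarrow>\<^sub>0 'k::field) set"
  assumes wf: "wf_digraph Q" and ideal: "two_sided_ideal Q \<Omega>"
    and R: "R \<subseteq> \<Omega>" "generated_ideal Q R = \<Omega>"
    and x: "x \<in> path_space Q" "\<And>p. p \<in> keys x \<Longrightarrow> ptarget Q p = n"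
    and arrows: "\<And>a. a \<in> arcs Q \<Longrightarrow> act Q (single (arrow_path Q a) 1) x \<in> path_coalgebra Q \<Omega>"
    and relations: "\<And>r. r \<in> R \<Longrightarrow> act Q r x = 0"
  shows "x \<in> path_coalgebra Q \<Omega>"
proof -
  define I where "I = {y \<in> \<Omega>. act Q y x = 0}"
  have I\<Omega>: "y \<in> \<Omega>" "y \<in> path_space Q" "act Q y x = 0" if "y \<in> I" for y
    using that two_sided_idealD(1)[OF ideal] by (auto simp: I_def)
  have path: "act Q y (act Q (single p c) x) = 0" if y: "y \<in> I" and p: "p \<in> paths Q" for y p c
  proof -
    obtain i as where ias: "p = (i, as)" by (cases p)
    show ?thesis
    proof (cases as rule: rev_cases)
      case Nil
      have "act Q (single p c) x = (if i = n then fscale c x else 0)"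
        unfolding ias Nil using x(2)
        by (intro poly_mapping_eqI) (auto simp: act_vertex[OF wf x(1)] in_keys_iff)
      then show ?thesis using I\<Omega>[OF y] by (simp add: act_fscale_right)
    next
      case (snoc as' a)
      have p': "(i, as' @ [a]) \<in> paths Q" using p ias snoc by simp
      have "act Q (single p c) x \<in> path_coalgebra Q \<Omega>"
        unfolding ias snoc act_single_snoc[OF wf p']
        using arrows[OF snoc_path(2)[OF wf p']] butlast_in_paths[OF p']
        by (rule act_in_path_coalgebra[OF ideal _ single_in_path_space])
      then show ?thesis
        using act_ideal_eq_0[OF ideal] I\<Omega>[OF y] by simp
    qed
  qed
  have right: "act Q y (act Q z x) = 0" if y: "y \<in> I" and z: "z \<in> path_space Q" for y z
  proof -
    have "act Q y (act Q z x) = (\<Sum>p\<in>keys z. act Q y (act Q (single p (lookup z p)) x))"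
      by (simp flip: act_sum_left act_sum_right add: sum_single_keys)
    also have "\<dots> = 0"
      using path[OF y] z by (intro sum.neutral) (auto simp: path_space_def)
    finally show ?thesis .
  qed
  have "two_sided_ideal Q I"
    unfolding two_sided_ideal_def
  proof (intro conjI ballI)
    show "I \<subseteq> path_space Q" using I\<Omega> by blast
    show "fs.subspace I"
      using two_sided_idealD(2)[OF ideal]
      by (auto simp: I_def fs.subspace_def act_add_left act_fscale_left)
    fix y z :: "('v, 'a) qpath \<Rightarrow>\<^sub>0 'k"
    assume y: "y \<in> I" and z: "z \<in> path_space Q"
    show "path_mult Q y z \<in> I"
      using two_sided_idealD(3)[OF ideal I\<Omega>(1)[OF y] z] right[OF y z]
      by (simp add: I_def act_path_mult I\<Omega>[OF y] z)
    show "path_mult Q z y \<in> I"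
      using two_sided_idealD(4)[OF ideal I\<Omega>(1)[OF y] z]
      by (simp add: I_def act_path_mult I\<Omega>[OF y] z)
  qed
  moreover have "R \<subseteq> I" using R(1) relations by (auto simp: I_def)
  ultimately have "\<Omega> \<subseteq> I" using R(2) by (auto simp: generated_ideal_def)
  then show ?thesis using x(1) by (intro path_coalgebraI_act) (auto simp: I_def)
qed

lemma comodule_hom_map_f:
  fixes \<Omega> :: "(('v, 'a) qpath \<Rightarrow>\<^sub>0 'k::field) set"
  assumes Q: "quiver_with_relations Q \<Omega>"
  defines "C \<equiv> path_coalgebra Q \<Omega>"
  shows "comodule_hom (vertex_comodule Q C n)
    (direct_sum (arrows_into Q n) (\<lambda>a. vertex_comodule Q C (tail Q a))) (map_f Q n)"
proof -
  have wf: "wf_digraph Q" and ideal: "two_sided_ideal Q \<Omega>"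
    using Q by (auto simp: quiver_with_relations_def)
  let ?E = "vertex_comodule Q C n"
  let ?F = "direct_sum (arrows_into Q n) (\<lambda>a. vertex_comodule Q C (tail Q a))"
  have "map_f Q n x a \<in> cspace (vertex_comodule Q C (tail Q a))"
    if "x \<in> cspace ?E" "a \<in> arrows_into Q n" for x a
    using that in_vertex_comoduleD(1)[OF wf ideal, of x n] unfolding C_def
    by (auto simp: map_f_apply arrows_into_def
        intro!: act_in_vertex_comodule[OF wf ideal] single_in_path_space arrow_in_paths[OF wf]
        split: if_splits)
  moreover have "{a. map_f Q n x a \<noteq> 0} \<subseteq> arrows_into Q n" for x :: "('v, 'a) qpath \<Rightarrow>\<^sub>0 'k"
    by (auto simp: map_f_apply split: if_splits)
  ultimately have "map_f Q n ` cspace ?E \<subseteq> cspace ?F"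
    by (auto simp: direct_sum_simps finite_support_map_f)
  moreover have "linear_map_on (cspace ?E) (cscale ?E) (cscale ?F) (map_f Q n)"
    by (auto simp: linear_map_on_def map_f_apply fun_eq_iff act_add_right act_fscale_right
        direct_sum_simps)
  moreover have "coact ?F (map_f Q n x) = Poly_Mapping.map (map_f Q n) (coact ?E x)"
    for x :: "('v, 'a) qpath \<Rightarrow>\<^sub>0 'k"
  proof (rule poly_mapping_eqI)
    fix p
    have "map_f Q n (0 :: ('v, 'a) qpath \<Rightarrow>\<^sub>0 'k) = 0"
      by (auto simp: map_f_apply)
    then have "lookup (Poly_Mapping.map (map_f Q n) (coact ?E x)) p = map_f Q n (slice Q x p)"
      by (simp add: lookup_map)
    also have "\<dots> = lookup (coact ?F (map_f Q n x)) p"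
      by (subst lookup_coact_direct_sum[OF _ finite_support_map_f])
        (auto simp: map_f_apply slice_act fun_eq_iff)
    finally show "lookup (coact ?F (map_f Q n x)) p
        = lookup (Poly_Mapping.map (map_f Q n) (coact ?E x)) p" ..
  qed
  ultimately show ?thesis by (simp add: comodule_hom_def)
qed

text \<open>
  Local finiteness of the relations makes the values of \<open>g\<close> finitely supported: if \<open>(r a\<^sup>-\<^sup>1) x\<close> is
  nonzero, then the source of \<open>r\<close> is one of the finitely many vertices on the paths in \<open>x\<close>, and
  only finitely many relations start at one of these vertices and end at \<open>n\<close>.
\<close>

lemma finite_support_map_g:
  assumes "minimal_relations Q \<Omega> R" "locally_finite_relations Q R" "n \<in> verts Q"
    and m: "finite {a. m a \<noteq> 0}"
  shows "finite {r. map_g Q R n m r \<noteq> 0}"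
proof (rule finite_subset)
  let ?V = "\<Union>a\<in>{a. m a \<noteq> 0}. ptarget Q ` keys (comult Q (m a))"
  let ?W = "\<Union>i\<in>?V \<inter> verts Q. {r \<in> R. rsource r = i \<and> rtarget Q r = n}"
  show "{r. map_g Q R n m r \<noteq> 0} \<subseteq> ?W"
  proof
    fix r assume "r \<in> {r. map_g Q R n m r \<noteq> 0}"
    then have "r \<in> relations_into Q R n"
      and "(\<Sum>a\<in>{a. m a \<noteq> 0}. act Q (strip_arrow r a) (m a)) \<noteq> 0"
      by (auto simp: map_g_apply split: if_splits)
    then have r: "r \<in> R" "rtarget Q r = n"
      and "\<exists>a\<in>{a. m a \<noteq> 0}. act Q (strip_arrow r a) (m a) \<noteq> 0"
      by (auto simp: relations_into_def intro: sum.neutral)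
    then obtain a where a: "m a \<noteq> 0" "act Q (strip_arrow r a) (m a) \<noteq> 0"
      by auto
    then obtain p where p: "p \<in> keys (act Q (strip_arrow r a) (m a))"
      by (metis all_not_in_conv keys_eq_empty)
    then have "slice Q (m a) p \<noteq> 0"
      by (auto simp: in_keys_iff lookup_act)
    then have "p \<in> keys (comult Q (m a))"
      by (simp add: in_keys_iff)
    moreover obtain q where "q \<in> keys (strip_arrow r a)" "composable Q p q"
      using p by (rule keys_actE)
    then have "rsource r = ptarget Q p"
      using relation_ends(1)[OF assms(1) r(1), of "(fst q, snd q @ [a])"]
      by (auto simp: in_keys_iff lookup_strip_arrow composable_def psource_def)
    ultimately show "r \<in> ?W"
      using r a(1) relation_ends(3)[OF assms(1) r(1)] by auto
  qed
  have "finite {r \<in> R. rsource r = i \<and> rtarget Q r = n}" if "i \<in> verts Q" for i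
    using that assms(2,3) by (simp add: locally_finite_relations_def)
  with m show "finite ?W" by auto
qed

lemma comodule_hom_map_g:
  fixes \<Omega> R :: "(('v, 'a) qpath \<Rightarrow>\<^sub>0 'k::field) set"
  assumes Q: "quiver_with_relations Q \<Omega>" and R: "minimal_relations Q \<Omega> R"
    and "locally_finite_relations Q R" "n \<in> verts Q"
  defines "C \<equiv> path_coalgebra Q \<Omega>"
  shows "comodule_hom (direct_sum (arrows_into Q n) (\<lambda>a. vertex_comodule Q C (tail Q a)))
    (direct_sum (relations_into Q R n) (\<lambda>r. vertex_comodule Q C (rsource r))) (map_g Q R n)"
proof -
  have wf: "wf_digraph Q" and ideal: "two_sided_ideal Q \<Omega>"
    using Q by (auto simp: quiver_with_relations_def)
  let ?F = "direct_sum (arrows_into Q n) (\<lambda>a. vertex_comodule Q C (tail Q a))"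
  let ?G = "direct_sum (relations_into Q R n) (\<lambda>r. vertex_comodule Q C (rsource r))"
  have RP: "r \<in> path_space Q" if "r \<in> R" for r
    using that R two_sided_idealD(1)[OF ideal] by (auto simp: minimal_relations_def)
  have finF: "finite {a. m a \<noteq> 0}" if "m \<in> cspace ?F" for m
    using that by (simp add: direct_sum_simps)
  \<comment> \<open>The sum over the support may be taken over any larger finite set, which gives additivity.\<close>
  have superset: "(\<Sum>a\<in>{a. m a \<noteq> 0}. act Q (strip_arrow r a) (m a))
      = (\<Sum>a\<in>A. act Q (strip_arrow r a) (m a))" if "finite A" "{a. m a \<noteq> 0} \<subseteq> A"
    for A r and m :: "'a \<Rightarrow> ('v, 'a) qpath \<Rightarrow>\<^sub>0 'k"
    using that by (intro sum.mono_neutral_left) auto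
  have summand: "act Q (strip_arrow r a) x \<in> cspace (vertex_comodule Q C (rsource r))"
    if "x \<in> C" "r \<in> R" for r a x
    using that(1) unfolding C_def
  proof (rule act_in_vertex_comodule[OF wf ideal])
    show "strip_arrow r a \<in> path_space Q"
      by (rule strip_arrow_in_path_space[OF RP[OF that(2)]])
    fix q assume "q \<in> keys (strip_arrow r a)"
    then show "psource q = rsource r"
      using relation_ends(1)[OF R that(2), of "(fst q, snd q @ [a])"]
      by (simp add: in_keys_iff lookup_strip_arrow psource_def)
  qed
  have C: "m a \<in> C" if "m \<in> cspace ?F" "m a \<noteq> 0" for m a
    using that in_vertex_comoduleD(1)[OF wf ideal] unfolding C_def
    by (auto simp: direct_sum_simps)
  have "map_g Q R n m r \<in> cspace (vertex_comodule Q C (rsource r))"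
    if "m \<in> cspace ?F" "r \<in> relations_into Q R n" for m r
    using that vertex_comodule_slice_closed(1)[OF wf ideal] C summand
    by (auto simp: map_g_apply C_def relations_into_def intro!: fs.subspace_sum)
  moreover have "{r. map_g Q R n m r \<noteq> 0} \<subseteq> relations_into Q R n" for m
    by (auto simp: map_g_apply split: if_splits)
  ultimately have "map_g Q R n ` cspace ?F \<subseteq> cspace ?G"
    using finite_support_map_g[OF assms(2-4)] finF
    by (auto simp: direct_sum_simps(1)[of "relations_into Q R n"])
  moreover have "linear_map_on (cspace ?F) (cscale ?F) (cscale ?G) (map_g Q R n)"
    unfolding linear_map_on_def
  proof (intro conjI ballI allI)
    fix m m' assume m: "m \<in> cspace ?F" and m': "m' \<in> cspace ?F"
    let ?A = "{a. m a \<noteq> 0} \<union> {a. m' a \<noteq> 0}"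
    have A: "finite ?A" using finF[OF m] finF[OF m'] by simp
    have "{a. (m + m') a \<noteq> 0} \<subseteq> ?A" by auto
    note superset[OF A this] superset[OF A, of m] superset[OF A, of m']
    then show "map_g Q R n (m + m') = map_g Q R n m + map_g Q R n m'"
      by (intro ext) (auto simp: map_g_apply act_add_right sum.distrib)
  next
    fix c m assume m: "m \<in> cspace ?F"
    have sub: "{a. cscale ?F c m a \<noteq> 0} \<subseteq> {a. m a \<noteq> 0}"
      by (auto simp: direct_sum_simps)
    show "map_g Q R n (cscale ?F c m) = cscale ?G c (map_g Q R n m)"
    proof
      fix r
      show "map_g Q R n (cscale ?F c m) r = cscale ?G c (map_g Q R n m) r"
        using superset[OF finF[OF m] sub, of r]
        by (simp add: map_g_apply direct_sum_simps act_fscale_right fs.scale_sum_right)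
    qed
  qed
  moreover have "coact ?G (map_g Q R n m) = Poly_Mapping.map (map_g Q R n) (coact ?F m)"
    if m: "m \<in> cspace ?F" for m
  proof (rule poly_mapping_eqI)
    fix p
    have sub: "{a. slice Q (m a) p \<noteq> 0} \<subseteq> {a. m a \<noteq> 0}" by auto
    have "map_g Q R n 0 = 0"
      by (auto simp: map_g_apply)
    then have "lookup (Poly_Mapping.map (map_g Q R n) (coact ?F m)) p
        = map_g Q R n (\<lambda>a. slice Q (m a) p)"
      by (subst lookup_map) (simp_all add: lookup_coact_direct_sum finF[OF m])
    also have "\<dots> = (\<lambda>r. slice Q (map_g Q R n m r) p)"
      by (intro ext)
        (simp add: map_g_apply superset[OF finF[OF m] sub] comult_sum lookup_sum slice_act)
    also have "\<dots> = lookup (coact ?G (map_g Q R n m)) p"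
      using finite_support_map_g[OF assms(2-4) finF[OF m]]
      by (subst lookup_coact_direct_sum) auto
    finally show "lookup (coact ?G (map_g Q R n m)) p
        = lookup (Poly_Mapping.map (map_g Q R n) (coact ?F m)) p" ..
  qed
  ultimately show ?thesis by (simp add: comodule_hom_def)
qed

text \<open>
  The trivial path at \<open>n\<close> pairs to 0 with \<open>\<Omega>\<close>, whose elements contain only paths of length at
  least 2.
\<close>

lemma simple_subset_vertex_comodule:
  assumes Q: "quiver_with_relations Q \<Omega>" and "n \<in> verts Q" "keys x \<subseteq> {(n, [])}"
  shows "x \<in> cspace (vertex_comodule Q (path_coalgebra Q \<Omega>) n)"
proof -
  have wf: "wf_digraph Q" and ideal: "two_sided_ideal Q \<Omega>"
    using Q by (auto simp: quiver_with_relations_def)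
  have "pairing x y = 0" if "y \<in> \<Omega>" for y
  proof (rule ccontr)
    assume "pairing x y \<noteq> 0"
    then obtain p where "p \<in> keys x" "p \<in> keys y" by (rule pairing_nonzeroE)
    then show False
      using relation_keys_length[OF Q that, of p] assms(3) by auto
  qed
  moreover have "x \<in> path_space Q"
    using assms(2,3) by (auto simp: path_space_def trivial_in_paths_iff)
  ultimately show ?thesis
    using assms(3) unfolding vertex_comodule_eq[OF wf ideal]
    by (auto simp: path_coalgebra_def ptarget_conv)
qed

lemma left_comodule_simple:
  fixes \<Omega> :: "(('v, 'a) qpath \<Rightarrow>\<^sub>0 'k::field) set"
  assumes Q: "quiver_with_relations Q \<Omega>" and "n \<in> verts Q"
  shows "left_comodule Q (path_coalgebra Q \<Omega>) (simple_comodule Q n)"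
  unfolding simple_comodule_eq
proof (rule left_comodule_subspace)
  have wf: "wf_digraph Q" and ideal: "two_sided_ideal Q \<Omega>"
    using Q by (auto simp: quiver_with_relations_def)
  show "two_sided_ideal Q \<Omega>" by (rule ideal)
  show "fs.subspace {x :: ('v, 'a) qpath \<Rightarrow>\<^sub>0 'k. keys x \<subseteq> {(n, [])}}"
    by (rule subspace_support)
  show "{x. keys x \<subseteq> {(n, [])}} \<subseteq> path_coalgebra Q \<Omega>"
    using simple_subset_vertex_comodule[OF assms] in_vertex_comoduleD(1)[OF wf ideal] by blast
  fix x :: "('v, 'a) qpath \<Rightarrow>\<^sub>0 'k" and p assume x: "x \<in> {x. keys x \<subseteq> {(n, [])}}"
  have "q = (n, [])" if "q \<in> keys (slice Q x p)" for q
  proof -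
    have "psource q = ptarget Q p" "pconcat p q \<in> keys x"
      using that by (auto simp: in_keys_iff lookup_slice composable_def split: if_splits)
    with x have "psource q = ptarget Q p" "pconcat p q = (n, [])" by auto
    then show ?thesis
      by (cases p; cases q) (simp add: pconcat_def psource_def ptarget_conv)
  qed
  then show "slice Q x p \<in> {x. keys x \<subseteq> {(n, [])}}" by blast
qed

lemma exact_at_vertex_comodule:
  assumes Q: "quiver_with_relations Q \<Omega>" and "n \<in> verts Q"
  shows "cspace (simple_comodule Q n)
    = {x \<in> cspace (vertex_comodule Q (path_coalgebra Q \<Omega>) n). map_f Q n x = 0}"
proof -
  have wf: "wf_digraph Q" and ideal: "two_sided_ideal Q \<Omega>"
    using Q by (auto simp: quiver_with_relations_def)
  show ?thesis
    using simple_subset_vertex_comodule[OF assms] map_f_eq_0_iff[OF wf]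
      in_vertex_comoduleD(2,3)[OF wf ideal]
    by (auto simp: simple_comodule_eq) blast+
qed

text \<open>
  The substance of the exactness: an element that \<open>g\<close> annihilates is lifted along \<open>f\<close> to \<open>CQ\<close>, and
  the vanishing of \<open>g\<close> says that the relations annihilate the lift, which puts it into \<open>C\<close>.
\<close>

lemma exact_at_arrows:
  assumes Q: "quiver_with_relations Q \<Omega>" and R: "minimal_relations Q \<Omega> R"
  defines "C \<equiv> path_coalgebra Q \<Omega>"
  shows "map_f Q n ` cspace (vertex_comodule Q C n)
    = {m \<in> cspace (direct_sum (arrows_into Q n) (\<lambda>a. vertex_comodule Q C (tail Q a))).
        map_g Q R n m = 0}"
proof -
  have wf: "wf_digraph Q" and ideal: "two_sided_ideal Q \<Omega>"
    using Q by (auto simp: quiver_with_relations_def)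
  let ?E = "vertex_comodule Q C n"
  let ?F = "direct_sum (arrows_into Q n) (\<lambda>a. vertex_comodule Q C (tail Q a))"
  have R\<Omega>: "R \<subseteq> \<Omega>" "generated_ideal Q R = \<Omega>"
    using R by (auto simp: minimal_relations_def)
  have gf: "map_g Q R n (map_f Q n x) r = act Q r x"
    if "\<And>p. p \<in> keys x \<Longrightarrow> ptarget Q p = n" "r \<in> relations_into Q R n" for x r
  proof (rule map_g_map_f[OF wf that])
    have "r \<in> \<Omega>" using that(2) R\<Omega> by (auto simp: relations_into_def)
    then show "r \<in> path_space Q" "\<And>p. p \<in> keys r \<Longrightarrow> snd p \<noteq> []"
      using two_sided_idealD(1)[OF ideal] relation_keys_length[OF Q, of r] by fastforce+
  qed
  show ?thesis
  proof (intro equalityI subsetI)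
    fix m assume "m \<in> map_f Q n ` cspace ?E"
    then obtain x where x: "x \<in> cspace ?E" and m: "m = map_f Q n x" by blast
    have "act Q r x = 0" if "r \<in> relations_into Q R n" for r
      using that R\<Omega> in_vertex_comoduleD(1)[OF wf ideal x[unfolded C_def]]
      by (auto simp: relations_into_def intro!: act_ideal_eq_0[OF ideal])
    then have "map_g Q R n m = 0"
      unfolding m using gf[OF in_vertex_comoduleD(3)[OF wf ideal x[unfolded C_def]]]
      by (intro ext) (auto simp: map_g_apply)
    moreover have "m \<in> cspace ?F"
      using comodule_hom_map_f[OF Q, of n] x by (auto simp: m comodule_hom_def C_def)
    ultimately show "m \<in> {m \<in> cspace ?F. map_g Q R n m = 0}" by simp
  next
    fix m assume "m \<in> {m \<in> cspace ?F. map_g Q R n m = 0}"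
    then have mF: "m \<in> cspace ?F" and g0: "map_g Q R n m = 0" by auto
    have supp: "finite {a. m a \<noteq> 0}" "{a. m a \<noteq> 0} \<subseteq> arrows_into Q n"
      using mF by (auto simp: direct_sum_simps)
    have ma: "m a \<in> cspace (vertex_comodule Q C (tail Q a))" for a
      using mF vertex_comodule_slice_closed(1)[OF wf ideal, THEN fs.subspace_0]
      by (cases "m a = 0") (auto simp: direct_sum_simps C_def)
    note maD = in_vertex_comoduleD[OF wf ideal ma[unfolded C_def]]
    obtain x where x: "x \<in> path_space Q" "\<And>p. p \<in> keys x \<Longrightarrow> ptarget Q p = n"
      and f: "map_f Q n x = m"
      using map_f_preimage[OF wf supp maD(2) maD(3)] by blast
    have "x \<in> path_coalgebra Q \<Omega>"
    proof (rule path_coalgebraI_relations[OF wf ideal R\<Omega> x])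
      fix a assume a: "a \<in> arcs Q"
      show "act Q (single (arrow_path Q a) 1) x \<in> path_coalgebra Q \<Omega>"
      proof (cases "head Q a = n")
        case True
        \<comment> \<open>This also covers arrows outside the support of \<open>m\<close>, where the component is 0.\<close>
        with a have "act Q (single (arrow_path Q a) 1) x = m a"
          by (simp add: map_f_apply arrows_into_def flip: f)
        then show ?thesis by (simp add: maD(1))
      next
        case False
        then show ?thesis
          using act_eq_0_if_targets_differ[of x Q n "single (arrow_path Q a) 1"] x(2)
          by (simp add: fs.subspace_0[OF subspace_path_coalgebra])
      qed
    next
      fix r assume r: "r \<in> R"
      show "act Q r x = 0"
      proof (cases "rtarget Q r = n")
        case True
        then show ?thesis
          using gf[of x r] x(2) g0 r by (simp add: f relations_into_def)
      next
        case False
        then show ?thesis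
          using relation_ends(2)[OF R r] x(2)
          by (intro act_eq_0_if_targets_differ[where n = n]) auto
      qed
    qed
    then have "x \<in> cspace ?E"
      using x(2) by (simp add: vertex_comodule_eq[OF wf ideal] C_def)
    then show "m \<in> map_f Q n ` cspace ?E" using f by blast
  qed
qed

theorem theorem3p1:
  fixes Q :: "('v, 'a) pre_digraph"
    and \<Omega> R :: "(('v, 'a) qpath \<Rightarrow>\<^sub>0 'k::{alg_closed_field, field_char_0}) set"
    and n :: 'v
  assumes "quiver_with_relations Q \<Omega>"
    and "minimal_relations Q \<Omega> R"
    and "locally_finite_relations Q R"
    and "n \<in> verts Q"
  shows
    "let C = path_coalgebra Q \<Omega>;
         S = simple_comodule Q n;
         E = vertex_comodule Q C n;
         F = direct_sum (arrows_into Q n) (\<lambda>a. vertex_comodule Q C (tail Q a));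
         G = direct_sum (relations_into Q R n) (\<lambda>r. vertex_comodule Q C (rsource r));
         f = map_f Q n;
         g = map_g Q R n
     in left_comodule Q C S \<and> left_comodule Q C E \<and> left_comodule Q C F \<and> left_comodule Q C G \<and>
        comodule_hom S E id \<and> comodule_hom E F f \<and> comodule_hom F G g \<and>
        exact_at {0} id (cspace S) id \<and>
        exact_at (cspace S) id (cspace E) f \<and>
        exact_at (cspace E) f (cspace F) g"
proof -
  have wf: "wf_digraph Q" and ideal: "two_sided_ideal Q \<Omega>"
    using assms(1) by (auto simp: quiver_with_relations_def)
  have "comodule_hom (simple_comodule Q n) (vertex_comodule Q (path_coalgebra Q \<Omega>) n) id"
    using simple_subset_vertex_comodule[OF assms(1,4)]
    by (auto simp: comodule_hom_def linear_map_on_def simple_comodule_eq lookup_map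
        intro!: poly_mapping_eqI)
  moreover have "exact_at {0} id (cspace (simple_comodule Q n)) id"
    by (auto simp: exact_at_def simple_comodule_eq)
  moreover have "exact_at (cspace (simple_comodule Q n)) id
      (cspace (vertex_comodule Q (path_coalgebra Q \<Omega>) n)) (map_f Q n)"
    unfolding exact_at_def image_id id_apply by (rule exact_at_vertex_comodule[OF assms(1,4)])
  moreover note exact_at_arrows[OF assms(1,2), of n, folded exact_at_def]
  ultimately show ?thesis
    unfolding Let_def
    by (intro conjI left_comodule_simple[OF assms(1,4)] left_comodule_vertex[OF wf ideal]
        left_comodule_direct_sum_vertex[OF wf ideal] comodule_hom_map_f[OF assms(1)]
        comodule_hom_map_g[OF assms])
qed

end
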